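(* Let $\alpha\ge 2$ be any constant. Then (1) there exists an efficient randomized algorithm that with high probability computes an $\alpha$-approximate Steiner Tree by performing $\tilde O(k^2/\alpha)$ queries; and (2) any randomized algorithm that outputs an $\alpha$-approximate Steiner Tree performs at least $\Omega(k^2/\alpha)$ queries in the worst case.
   Context: An instance of the metric Steiner Tree problem is a triple $(V,T,w)$ where $V$ is a set of $n$ points, $T\subseteq V$ is a set of $k$ terminals, and $w$ is a metric on $V$. A Steiner tree is a tree whose vertices are points of $V$ and which contains all points of $T$; its cost is the sum of $w(u,v)$ over its edges $(u,v)$. ${\mathsf{ST}}(V,T,w)$ denotes the minimum cost of a Steiner tree. A $\beta$-approximate Steiner tree is a Steiner tree of cost at most $\beta\cdot{\mathsf{ST}}(V,T,w)$. An algorithm knows $V$ and $T$ but can access $w$ only through queries: a query specifies a pair $u,v\in V$ and returns $w(u,v)$. $\tilde O(\cdot)$ hides polylogarithmic factors. *)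

theory Defs
  imports "HOL-Probability.Probability"
begin

section \<open>Steiner trees in finite metrics\<close>

text \<open>A graph is a pair of a vertex set and a set of two-element edges.\<close>

type_synonym graph = "nat set \<times> nat set set"

definition simple_graph :: "graph \<Rightarrow> bool" where
  "simple_graph G \<longleftrightarrow> snd G \<subseteq> {{u, v} |u v. u \<in> fst G \<and> v \<in> fst G \<and> u \<noteq> v}"

definition connected_graph :: "graph \<Rightarrow> bool" where
  "connected_graph G \<longleftrightarrow> fst G \<noteq> {} \<and>
     (\<forall>u \<in> fst G. \<forall>v \<in> fst G. (u, v) \<in> {(x, y). {x, y} \<in> snd G}\<^sup>*)"

definition is_cycle :: "graph \<Rightarrow> nat list \<Rightarrow> bool" where
  "is_cycle G xs \<longleftrightarrow> length xs \<ge> 3 \<and> distinct xs \<and>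
     (\<forall>i < length xs. {xs ! i, xs ! (Suc i mod length xs)} \<in> snd G)"

definition is_tree :: "graph \<Rightarrow> bool" where
  "is_tree G \<longleftrightarrow> simple_graph G \<and> connected_graph G \<and> (\<nexists>xs. is_cycle G xs)"

definition steiner_tree :: "nat set \<Rightarrow> nat set \<Rightarrow> graph \<Rightarrow> bool" where
  "steiner_tree V T G \<longleftrightarrow> is_tree G \<and> fst G \<subseteq> V \<and> T \<subseteq> fst G"

text \<open>The weights are symmetric, so the order in which the endpoints of an edge are passed to
  \<open>w\<close> is immaterial.\<close>

definition cost :: "(nat \<Rightarrow> nat \<Rightarrow> real) \<Rightarrow> graph \<Rightarrow> real" where
  "cost w G = (\<Sum>e \<in> snd G. w (Min e) (Max e))"

definition ST :: "nat set \<Rightarrow> nat set \<Rightarrow> (nat \<Rightarrow> nat \<Rightarrow> real) \<Rightarrow> real" where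
  "ST V T w = Min (cost w ` {G. steiner_tree V T G})"

definition approx_steiner_tree ::
  "real \<Rightarrow> nat set \<Rightarrow> nat set \<Rightarrow> (nat \<Rightarrow> nat \<Rightarrow> real) \<Rightarrow> graph \<Rightarrow> bool" where
  "approx_steiner_tree \<beta> V T w G \<longleftrightarrow> steiner_tree V T G \<and> cost w G \<le> \<beta> * ST V T w"


section \<open>Query algorithms\<close>

text \<open>A deterministic query algorithm for fixed \<open>V\<close> and \<open>T\<close> is a decision tree, with no bound on
  the computation between queries. The answer \<open>None\<close> means that no graph is output. A randomized
  algorithm is a function from random seeds to decision trees.\<close>

datatype dtree = Answer "graph option" | Ask nat nat "real \<Rightarrow> dtree"

primrec result :: "(nat \<Rightarrow> nat \<Rightarrow> real) \<Rightarrow> dtree \<Rightarrow> graph option" where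
  "result w (Answer r) = r"
| "result w (Ask u v f) = result w (f (w u v))"

primrec queries :: "(nat \<Rightarrow> nat \<Rightarrow> real) \<Rightarrow> dtree \<Rightarrow> (nat \<times> nat) list" where
  "queries w (Answer r) = []"
| "queries w (Ask u v f) = (u, v) # queries w (f (w u v))"

definition succeeds ::
  "real \<Rightarrow> nat set \<Rightarrow> nat set \<Rightarrow> (nat \<Rightarrow> nat \<Rightarrow> real) \<Rightarrow> dtree \<Rightarrow> bool" where
  "succeeds \<beta> V T w A \<longleftrightarrow> (\<exists>G. result w A = Some G \<and> approx_steiner_tree \<beta> V T w G)"


section \<open>A random access machine with a distance oracle\<close>

text \<open>Running time is the number of steps of the following uniform machine. It has finitely many
  unbounded arrays of natural numbers and of real numbers, identified by the natural numbers
  occurring in the program text; a scalar variable is a cell of an array. As usual in the unit-cost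
  model, multiplication is not a primitive operation, so that polynomially many steps produce
  numbers of polynomial bit length only. Real numbers are query answers and can be added,
  subtracted and compared, but not converted to natural numbers.\<close>

datatype nexp = NConst nat | NRead nat nexp | NAdd nexp nexp | NSub nexp nexp

datatype rexp = RZero | RRead nat nexp | RAdd rexp rexp | RSub rexp rexp

datatype bexp = NLess nexp nexp | RLess rexp rexp | BNot bexp | BAnd bexp bexp

datatype com =
    NWrite nat nexp nexp
  | RWrite nat nexp rexp
  | Flip nat nexp
  | Dist nat nexp nexp nexp
  | PutVertex nexp
  | PutEdge nexp nexp
  | Seq com com
  | Cond bexp com com
  | While bexp com

record state =
  narr :: "nat \<Rightarrow> nat \<Rightarrow> nat"
  rarr :: "nat \<Rightarrow> nat \<Rightarrow> real"
  flips :: nat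
  out :: graph

primrec nval :: "state \<Rightarrow> nexp \<Rightarrow> nat" where
  "nval s (NConst c) = c"
| "nval s (NRead a i) = narr s a (nval s i)"
| "nval s (NAdd x y) = nval s x + nval s y"
| "nval s (NSub x y) = nval s x - nval s y"

primrec rval :: "state \<Rightarrow> rexp \<Rightarrow> real" where
  "rval s RZero = 0"
| "rval s (RRead a i) = rarr s a (nval s i)"
| "rval s (RAdd x y) = rval s x + rval s y"
| "rval s (RSub x y) = rval s x - rval s y"

primrec bval :: "state \<Rightarrow> bexp \<Rightarrow> bool" where
  "bval s (NLess x y) \<longleftrightarrow> nval s x < nval s y"
| "bval s (RLess x y) \<longleftrightarrow> rval s x < rval s y"
| "bval s (BNot b) \<longleftrightarrow> \<not> bval s b"
| "bval s (BAnd b c) \<longleftrightarrow> bval s b \<and> bval s c"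

definition nupd :: "nat \<Rightarrow> nat \<Rightarrow> nat \<Rightarrow> state \<Rightarrow> state" where
  "nupd a i x s = s\<lparr>narr := (narr s)(a := (narr s a)(i := x))\<rparr>"

definition rupd :: "nat \<Rightarrow> nat \<Rightarrow> real \<Rightarrow> state \<Rightarrow> state" where
  "rupd a i x s = s\<lparr>rarr := (rarr s)(a := (rarr s a)(i := x))\<rparr>"

text \<open>\<open>exec t \<omega> cs s\<close> is the decision tree obtained by running the commands \<open>cs\<close> one after the
  other from state \<open>s\<close> for at most \<open>t\<close> steps, reading coin flips from the tape \<open>\<omega>\<close>. The answer is
  \<open>None\<close> exactly if the machine has not halted within \<open>t\<close> steps.\<close>

fun exec :: "nat \<Rightarrow> (nat \<Rightarrow> bool) \<Rightarrow> com list \<Rightarrow> state \<Rightarrow> dtree" where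
  "exec t \<omega> [] s = Answer (Some (out s))"
| "exec 0 \<omega> (c # cs) s = Answer None"
| "exec (Suc t) \<omega> (NWrite a i x # cs) s = exec t \<omega> cs (nupd a (nval s i) (nval s x) s)"
| "exec (Suc t) \<omega> (RWrite a i x # cs) s = exec t \<omega> cs (rupd a (nval s i) (rval s x) s)"
| "exec (Suc t) \<omega> (Flip a i # cs) s =
     exec t \<omega> cs (nupd a (nval s i) (of_bool (\<omega> (flips s))) (s\<lparr>flips := Suc (flips s)\<rparr>))"
| "exec (Suc t) \<omega> (Dist a i x y # cs) s =
     Ask (nval s x) (nval s y) (\<lambda>r. exec t \<omega> cs (rupd a (nval s i) r s))"
| "exec (Suc t) \<omega> (PutVertex x # cs) s =
     exec t \<omega> cs (s\<lparr>out := (insert (nval s x) (fst (out s)), snd (out s))\<rparr>)"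
| "exec (Suc t) \<omega> (PutEdge x y # cs) s =
     exec t \<omega> cs (s\<lparr>out := (fst (out s), insert {nval s x, nval s y} (snd (out s)))\<rparr>)"
| "exec (Suc t) \<omega> (Seq c d # cs) s = exec t \<omega> (c # d # cs) s"
| "exec (Suc t) \<omega> (Cond b c d # cs) s = exec t \<omega> ((if bval s b then c else d) # cs) s"
| "exec (Suc t) \<omega> (While b c # cs) s =
     exec t \<omega> (if bval s b then c # While b c # cs else cs) s"

text \<open>Input encoding for \<open>V = {..<n}\<close>: array 0 holds \<open>n\<close> and the number of terminals, array 1 lists
  the terminals in increasing order.\<close>

definition input :: "nat \<Rightarrow> nat set \<Rightarrow> state" where
  "input n T = \<lparr>
     narr = (\<lambda>a i. if a = 0 \<and> i = 0 then n
                   else if a = 0 \<and> i = 1 then card T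
                   else if a = 1 \<and> i < card T then sorted_list_of_set T ! i
                   else 0),
     rarr = (\<lambda>a i. 0), flips = 0, out = ({}, {})\<rparr>"

definition fair_coins :: "(nat \<Rightarrow> bool) measure" where
  "fair_coins = Pi\<^sub>M UNIV (\<lambda>_. measure_pmf (bernoulli_pmf (1/2)))"

end

theory Submission
  imports Defs
begin

text \<open>Upper bound: split the terminals into \<open>g = \<lfloor>(\<alpha> + 1) / 3\<rfloor>\<close> groups of almost equal size, query all
  distances inside the groups, take a minimum spanning tree of each group and join these trees by
  \<open>g - 1\<close> arbitrary edges. A walk that uses each edge of an optimal Steiner tree twice
  shows that each spanning tree costs at most \<open>2 ST\<close>, and no distance between terminals exceeds \<open>ST\<close>; so the total cost is at most
  \<open>(3 g - 1) ST\<close>. No random bits are needed.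

  Lower bound: label \<open>k\<close> terminals at random with \<open>m \<approx> k / (8 \<alpha>)\<close> labels and let equally labelled
  terminals have distance 1 and all other pairs distance \<open>k\<close>. A good tree must join most terminals to
  terminals with the same label, but if the label of a terminal varies and everything else is
  fixed, then each query involving this terminal rules out at most one label.\<close>

section \<open>Trees and their costs\<close>

text \<open>No minimum spanning trees are ever compared. One growing tree serves all groups, and the
  invariant bounds the cost paid so far plus the weight of edge sets that would still finish each
  group, its visited part being contracted to a point. At first these sets come from the walk.

  For the lower bound, a tree with one long edge per label costs at most k + m k, and \<alpha> times
  this is about k^2 / 8. So an approximate tree affords few edges of length k and must know a
  partner for at least half of the terminals. A blind guess is right for about one label in m, and
  ruling out a constant fraction of m labels for a constant fraction of k terminals takes about k m,
  that is k^2 / \<alpha>, queries. The obstacle is that queries adapt to answers; it is met by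
  following the labels of a single terminal through the decision tree and averaging over labellings
  afterwards.\<close>

lemma simple_graph_edge:
  assumes "simple_graph G" "e \<in> snd G"
  shows "e \<subseteq> fst G"
proof -
  have "e \<in> {{u, v} |u v. u \<in> fst G \<and> v \<in> fst G \<and> u \<noteq> v}"
    using assms unfolding simple_graph_def by (rule subsetD)
  then show ?thesis by blast
qed

lemma is_tree_singleton: "is_tree ({x}, {})"
  unfolding is_tree_def simple_graph_def connected_graph_def is_cycle_def
  by (auto intro!: exI[of _ 0])

text \<open>A cycle through the new leaf \<open>x\<close> would have \<open>a\<close> as both
  neighbours of \<open>x\<close>, but a cycle has at least three vertices and repeats none.\<close>

lemma is_tree_insert:
  assumes "is_tree (S, E)" "a \<in> S" "x \<notin> S"
  shows "is_tree (insert x S, insert {a, x} E)"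
proof -
  have E: "E \<subseteq> {{u, v} |u v. u \<in> S \<and> v \<in> S \<and> u \<noteq> v}"
    and conn: "\<And>u v. u \<in> S \<Longrightarrow> v \<in> S \<Longrightarrow> (u, v) \<in> {(x, y). {x, y} \<in> E}\<^sup>*"
    and acyclic: "\<And>xs. \<not> is_cycle (S, E) xs"
    using assms(1) by (auto simp: is_tree_def simple_graph_def connected_graph_def)
  let ?R = "{(y, z). {y, z} \<in> insert {a, x} E}"
  have mono: "{(x, y). {x, y} \<in> E}\<^sup>* \<subseteq> ?R\<^sup>*"
    by (rule rtrancl_mono) auto
  have ax: "(a, x) \<in> ?R" "(x, a) \<in> ?R"
    by (auto simp: insert_commute)
  have "(u, v) \<in> ?R\<^sup>*" if "u \<in> insert x S" "v \<in> insert x S" for u v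
  proof -
    have "(u, a) \<in> ?R\<^sup>*"
      using that(1) conn[of u a] mono ax(2) assms(2) by blast
    moreover have "(a, v) \<in> ?R\<^sup>*"
      using that(2) conn[of a v] mono ax(1) assms(2) by blast
    ultimately show ?thesis
      by (rule rtrancl_trans)
  qed
  moreover have "simple_graph (insert x S, insert {a, x} E)"
    unfolding simple_graph_def fst_conv snd_conv
  proof (rule insert_subsetI)
    show "{a, x} \<in> {{u, v} |u v. u \<in> insert x S \<and> v \<in> insert x S \<and> u \<noteq> v}"
      using assms(2,3) by blast
    show "E \<subseteq> {{u, v} |u v. u \<in> insert x S \<and> v \<in> insert x S \<and> u \<noteq> v}"
      using E by (rule subset_trans) blast
  qed
  moreover have "\<not> is_cycle (insert x S, insert {a, x} E) xs" for xs
  proof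
    assume cyc: "is_cycle (insert x S, insert {a, x} E) xs"
    define m where "m = length xs"
    have m: "m \<ge> 3" and dist: "distinct xs"
      and edge: "\<And>i. i < m \<Longrightarrow> {xs ! i, xs ! (Suc i mod m)} \<in> insert {a, x} E"
      using cyc by (auto simp: is_cycle_def m_def)
    have xE: "e \<in> E \<Longrightarrow> x \<notin> e" for e
      using E assms(3) by auto
    show False
    proof (cases "x \<in> set xs")
      case False
      then have "xs ! i \<noteq> x" if "i < m" for i
        using that by (auto simp: m_def)
      then have "{xs ! i, xs ! (Suc i mod m)} \<in> E" if "i < m" for i
        using edge[OF that] that m by (auto simp: doubleton_eq_iff)
      then have "is_cycle (S, E) xs"
        using m dist by (auto simp: is_cycle_def m_def)
      then show False
        using acyclic by blast
    next
      case True
      then obtain j where j: "j < m" "xs ! j = x"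
        by (auto simp: in_set_conv_nth m_def)
      have only: "y = a" if "{x, y} \<in> insert {a, x} E" for y
        using that xE[of "{x, y}"] by (auto simp: doubleton_eq_iff)
      \<comment> \<open>\<open>i\<close> is the position cyclically before \<open>j\<close>.\<close>
      define i where "i = (if j = 0 then m - 1 else j - 1)"
      have i: "i < m" "Suc i mod m = j"
        using m j by (auto simp: i_def)
      have "xs ! i = a"
        using edge[OF i(1)] only i(2) j(2) by (auto simp: insert_commute)
      moreover have "xs ! (Suc j mod m) = a"
        using edge[OF j(1)] only j(2) by auto
      moreover have "Suc j mod m < m"
        using m by auto
      ultimately have "i = Suc j mod m"
        using i(1) nth_eq_iff_index_eq[OF dist, of i "Suc j mod m"] by (simp add: m_def)
      then show False
        using m j(1) by (auto simp: i_def mod_Suc split: if_splits)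
    qed
  qed
  ultimately show ?thesis
    by (simp add: is_tree_def connected_graph_def)
qed

text \<open>Taking the last crossing keeps the rest of the path outside \<open>S\<close>. The
  exchange argument relies on this: the rest cannot use the crossing edge that gets deleted.\<close>

lemma rtrancl_last_crossing:
  assumes "(s, x) \<in> R\<^sup>*" "s \<in> S" "x \<notin> S"
  shows "\<exists>a b. a \<in> S \<and> b \<notin> S \<and> (a, b) \<in> R \<and> (b, x) \<in> (R \<inter> (- S) \<times> (- S))\<^sup>*"
  using assms(1,3)
proof (induction rule: rtrancl_induct)
  case base
  then show ?case using assms(2) by simp
next
  case (step y z)
  show ?case
  proof (cases "y \<in> S")
    case True
    with step show ?thesis by blast
  next
    case False
    with step.IH obtain a b where ab: "a \<in> S" "b \<notin> S" "(a, b) \<in> R"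
      "(b, y) \<in> (R \<inter> (- S) \<times> (- S))\<^sup>*"
      by blast
    have "(b, z) \<in> (R \<inter> (- S) \<times> (- S))\<^sup>*"
      using ab(4) step.hyps step.prems False by (auto intro: rtrancl_into_rtrancl)
    with ab show ?thesis by blast
  qed
qed

lemma finite_simple_graph:
  assumes "simple_graph G" "fst G \<subseteq> V" "finite V"
  shows "finite (snd G)"
proof (rule finite_subset)
  show "snd G \<subseteq> Pow V"
    using simple_graph_edge[OF assms(1)] assms(2) by blast
qed (use assms(3) in simp)

lemma finite_steiner_trees:
  assumes "finite V"
  shows "finite {G. steiner_tree V T G}"
proof (rule finite_subset)
  show "{G. steiner_tree V T G} \<subseteq> Pow V \<times> Pow (Pow V)"
  proof
    fix G
    assume "G \<in> {G. steiner_tree V T G}"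
    then have "simple_graph G" "fst G \<subseteq> V"
      by (auto simp: steiner_tree_def is_tree_def)
    with simple_graph_edge[of G] have "snd G \<subseteq> Pow V" "fst G \<in> Pow V"
      by blast+
    then show "G \<in> Pow V \<times> Pow (Pow V)"
      by (cases G) simp
  qed
qed (use assms in simp)

lemma edge_weight:
  assumes "\<And>x y :: nat. w x y = w y x"
  shows "w (Min {u, v}) (Max {u, v}) = w u v"
  using assms by (cases "u \<le> v") (auto simp: min_def max_def)

lemma cost_nonneg:
  assumes "Metric_space M w"
  shows "cost w G \<ge> 0"
  using assms by (auto simp: cost_def Metric_space_def intro!: sum_nonneg)

lemma cost_insert:
  assumes "Metric_space M w" "finite E" "{a, x} \<notin> E"
  shows "cost w (S', insert {a, x} E) = cost w (S, E) + w a x"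
proof -
  have "w (Min {a, x}) (Max {a, x}) = w a x"
    using assms(1) by (intro edge_weight) (auto simp: Metric_space_def)
  then show ?thesis
    using assms(2,3) by (simp add: cost_def)
qed

lemma ST_le:
  assumes "finite V" "steiner_tree V T G"
  shows "ST V T w \<le> cost w G"
  unfolding ST_def using assms by (intro Min_le) (auto simp: finite_steiner_trees)

lemma ST_attained:
  assumes "finite V" "steiner_tree V T G"
  obtains G' where "steiner_tree V T G'" "cost w G' = ST V T w"
proof -
  have "ST V T w \<in> cost w ` {G. steiner_tree V T G}"
    unfolding ST_def
    using assms by (intro Min_in finite_imageI finite_steiner_trees) blast+
  then show thesis
    using that by auto
qed

section \<open>Walks\<close>

fun walk_length :: "(nat \<Rightarrow> nat \<Rightarrow> real) \<Rightarrow> nat list \<Rightarrow> real" where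
  "walk_length w (x # y # zs) = w x y + walk_length w (y # zs)"
| "walk_length w _ = 0"

fun walk_edges :: "nat list \<Rightarrow> nat set set" where
  "walk_edges (x # y # zs) = insert {x, y} (walk_edges (y # zs))"
| "walk_edges _ = {}"

text \<open>Adjacency in \<open>E\<close> after \<open>S\<close> is shrunk to one point.
  \<open>S\<close> will be the visited part of a group; the growing tree already joins it, so moving
  inside it is free.\<close>

definition contracted :: "nat set set \<Rightarrow> nat set \<Rightarrow> (nat \<times> nat) set" where
  "contracted E S = {(x, y). {x, y} \<in> E} \<union> S \<times> S"

definition weight :: "(nat \<Rightarrow> nat \<Rightarrow> real) \<Rightarrow> nat set set \<Rightarrow> real" where
  "weight w E = (\<Sum>e\<in>E. w (Min e) (Max e))"

lemma cost_eq_weight: "cost w G = weight w (snd G)"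
  by (simp add: cost_def weight_def)

lemma finite_walk_edges [simp]: "finite (walk_edges xs)"
  by (induction xs rule: walk_edges.induct) auto

lemma walk_edges_ends: "e \<in> walk_edges xs \<Longrightarrow> \<exists>u \<in> set xs. \<exists>v \<in> set xs. e = {u, v}"
  by (induction xs rule: walk_edges.induct) auto

lemma contracted_mono: "E \<subseteq> E' \<Longrightarrow> S \<subseteq> S' \<Longrightarrow> contracted E S \<subseteq> contracted E' S'"
  unfolding contracted_def by blast

lemma sym_contracted: "sym (contracted E S)"
  by (auto simp: contracted_def sym_def insert_commute)

lemma walk_edges_connect:
  "u \<in> set xs \<Longrightarrow> v \<in> set xs \<Longrightarrow> (u, v) \<in> (contracted (walk_edges xs) S)\<^sup>*"
proof (induction xs arbitrary: u v rule: walk_edges.induct)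
  case (1 x y zs)
  let ?R = "contracted (walk_edges (x # y # zs)) S"
  have "contracted (walk_edges (y # zs)) S \<subseteq> ?R"
    by (rule contracted_mono) auto
  then have IH: "(u, v) \<in> ?R\<^sup>*" if "u \<in> set (y # zs)" "v \<in> set (y # zs)" for u v
    using 1(1)[OF that] rtrancl_mono by blast
  have xy: "(x, y) \<in> ?R" "(y, x) \<in> ?R"
    by (auto simp: contracted_def insert_commute)
  have "(u, y) \<in> ?R\<^sup>*"
    using IH[of u y] xy(1) 1(2) by (cases "u = x") auto
  moreover have "(y, v) \<in> ?R\<^sup>*"
    using IH[of y v] xy(2) 1(3) by (cases "v = x") auto
  ultimately show ?case
    by (rule rtrancl_trans)
qed auto

text \<open>This is how a walk doubles an edge: the new vertex is visited from \<open>a\<close> and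
  left again at once.\<close>

lemma walk_length_detour:
  "walk_length w (xs @ a # b # a # ys) = walk_length w (xs @ a # ys) + w a b + w b a"
proof (induction xs rule: induct_list012)
  case 1
  then show ?case by (cases ys) auto
next
  case (2 x)
  then show ?case by (cases ys) auto
qed auto

context
  fixes V :: "nat set" and w :: "nat \<Rightarrow> nat \<Rightarrow> real"
  assumes metric: "Metric_space V w"
begin

interpretation Metric_space V w
  by (rule metric)

lemma metric_edge_weight: "w (Min {u, v}) (Max {u, v}) = w u v"
  by (rule edge_weight) (rule commute)

lemma weight_nonneg: "weight w E \<ge> 0"
  unfolding weight_def by (intro sum_nonneg) simp

lemma weight_insert: "finite E \<Longrightarrow> {a, b} \<notin> E \<Longrightarrow> weight w (insert {a, b} E) = w a b + weight w E"
  by (simp add: weight_def metric_edge_weight[simplified])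

lemma weight_insert_le: "finite E \<Longrightarrow> weight w (insert {a, b} E) \<le> w a b + weight w E"
  by (cases "{a, b} \<in> E") (simp_all add: weight_insert insert_absorb)

lemma weight_remove: "finite E \<Longrightarrow> {a, b} \<in> E \<Longrightarrow> weight w (E - {{a, b}}) = weight w E - w a b"
  unfolding weight_def by (simp add: sum_diff1 metric_edge_weight[simplified])

lemma weight_walk_edges_le: "weight w (walk_edges xs) \<le> walk_length w xs"
proof (induction xs rule: walk_edges.induct)
  case (1 x y zs)
  then show ?case
    using weight_insert_le[of "walk_edges (y # zs)" x y] by simp
qed (auto simp: weight_def)

text \<open>The first point is kept whatever \<open>P\<close> says, so every skipped point has a
  predecessor at which the triangle inequality applies.\<close>

lemma walk_length_shortcut:
  assumes "set (x # xs) \<subseteq> V"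
  shows "walk_length w (x # filter P xs) \<le> walk_length w (x # xs)"
  using assms
proof (induction xs arbitrary: x)
  case (Cons y ys)
  show ?case
  proof (cases "P y")
    case True
    then show ?thesis
      using Cons by simp
  next
    case False
    have "walk_length w (x # ys) \<le> walk_length w (x # y # ys)"
    proof (cases ys)
      case (Cons z zs)
      then show ?thesis
        using triangle[of x y z] Cons.prems by simp
    qed simp
    with Cons.IH[of x] Cons.prems False show ?thesis
      by simp
  qed
qed simp

lemma walk_length_filter:
  assumes "set xs \<subseteq> V"
  shows "walk_length w (filter P xs) \<le> walk_length w xs"
  using assms
proof (induction xs)
  case (Cons x xs)
  have "walk_length w xs \<le> walk_length w (x # xs)"
    by (cases xs) auto
  then show ?case
    using Cons walk_length_shortcut[of x xs P] by (cases "P x") auto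
qed simp

text \<open>The vertices are collected one by one. Connectedness provides an edge that leaves the
  collected set; it lengthens the walk by twice its weight, and a distance to its new end exceeds an
  old distance by at most this weight. So both bounds persist relative to the edges collected so
  far.\<close>

lemma covering_walk:
  assumes G: "connected_graph G" "simple_graph G" "finite (fst G)" "fst G \<subseteq> V"
  shows "\<exists>xs. set xs = fst G \<and> walk_length w xs \<le> 2 * cost w G \<and>
    (\<forall>u \<in> fst G. \<forall>v \<in> fst G. w u v \<le> cost w G)"
proof -
  have fin: "finite (snd G)"
    using finite_simple_graph G by blast
  have "\<exists>xs F. F \<subseteq> snd G \<and> (\<forall>e\<in>F. e \<subseteq> set xs) \<and> set xs \<subseteq> fst G \<and> card (set xs) = Suc j \<and>
      walk_length w xs \<le> 2 * weight w F \<and> (\<forall>u \<in> set xs. \<forall>v \<in> set xs. w u v \<le> weight w F)"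
    if "Suc j \<le> card (fst G)" for j
    using that
  proof (induction j)
    case 0
    obtain v where v: "v \<in> fst G"
      using G(1) by (auto simp: connected_graph_def)
    then show ?case
      using G(4) by (intro exI[of _ "[v]"] exI[of _ "{}"]) (auto simp: weight_def)
  next
    case (Suc j)
    obtain xs F where xs: "F \<subseteq> snd G" "\<forall>e\<in>F. e \<subseteq> set xs" "set xs \<subseteq> fst G"
      "card (set xs) = Suc j" "walk_length w xs \<le> 2 * weight w F"
      and pairs: "\<forall>u \<in> set xs. \<forall>v \<in> set xs. w u v \<le> weight w F"
      using Suc.IH[OF Suc_leD[OF Suc.prems]] by blast
    obtain s where s: "s \<in> set xs"
      using xs(4) by fastforce
    obtain z where z: "z \<in> fst G" "z \<notin> set xs"
      using xs(3,4) Suc.prems by (metis Suc_n_not_le_n subsetI subset_antisym)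
    have "(s, z) \<in> {(x, y). {x, y} \<in> snd G}\<^sup>*"
      using G(1) s z xs(3) unfolding connected_graph_def by blast
    from rtrancl_last_crossing[OF this s z(2)]
    obtain a b where ab: "a \<in> set xs" "b \<notin> set xs" "{a, b} \<in> snd G"
      by blast
    have b: "b \<in> fst G"
      using simple_graph_edge[OF G(2) ab(3)] by simp
    obtain ys zs where split: "xs = ys @ a # zs"
      using ab(1) by (meson split_list)
    define xs' where "xs' = ys @ a # b # a # zs"
    define F' where "F' = insert {a, b} F"
    have set': "set xs' = insert b (set xs)"
      by (auto simp: xs'_def split)
    \<comment> \<open>All edges in \<open>F\<close> have both ends on the walk, so the new edge is
      not among them and its weight is added in full.\<close>
    have F': "weight w F' = w a b + weight w F"
      unfolding F'_def using xs(1,2) ab(2) finite_subset[OF _ fin] by (intro weight_insert) auto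
    have len: "walk_length w xs' \<le> 2 * weight w F'"
      using xs(5) unfolding xs'_def walk_length_detour F' split
      by (simp add: commute[of b a])
    have to_b: "w u b \<le> weight w F'" if "u \<in> set xs" for u
    proof -
      have "w u b \<le> w u a + w a b"
        using that ab(1) b xs(3) G(4) by (intro triangle) auto
      with pairs[rule_format, OF that ab(1)] show ?thesis
        by (simp add: F')
    qed
    have "w u v \<le> weight w F'" if uv: "u \<in> set xs'" "v \<in> set xs'" for u v
    proof -
      consider "u = b" "v = b" | "u = b" "v \<in> set xs" | "v = b" "u \<in> set xs" | "u \<in> set xs" "v \<in> set xs"
        using uv by (auto simp: set')
      then show ?thesis
      proof cases
        case 1
        then show ?thesis using b G(4) weight_nonneg[of F'] by auto
      next
        case 2
        then show ?thesis using to_b[of v] by (simp add: commute[of b v])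
      next
        case 3
        then show ?thesis using to_b by simp
      next
        case 4
        then show ?thesis
          using pairs[rule_format, OF 4] nonneg[of a b] unfolding F' by linarith
      qed
    qed
    moreover have "e \<subseteq> set xs'" if "e \<in> F'" for e
      using that xs(2) ab(1) unfolding F'_def set' by blast
    moreover have "card (set xs') = Suc (Suc j)"
      using xs(4) ab(2) by (simp add: set')
    moreover have "F' \<subseteq> snd G" "set xs' \<subseteq> fst G"
      using xs(1,3) ab(3) b by (auto simp: F'_def set')
    ultimately show ?case
      using len by blast
  qed
  moreover have "Suc (card (fst G) - 1) = card (fst G)"
    using G(1,3) by (simp add: connected_graph_def card_gt_0_iff)
  ultimately obtain xs F where xs: "F \<subseteq> snd G" "set xs \<subseteq> fst G"
    "card (set xs) = card (fst G)" "walk_length w xs \<le> 2 * weight w F"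
    "\<forall>u \<in> set xs. \<forall>v \<in> set xs. w u v \<le> weight w F"
    by (metis order_refl)
  have "weight w F \<le> cost w G"
    unfolding cost_eq_weight weight_def using xs(1) fin by (intro sum_mono2) auto
  moreover have "set xs = fst G"
    using xs(2,3) G(3) by (simp add: card_subset_eq)
  ultimately show ?thesis
    using xs(4,5) by (metis order_trans mult_left_mono zero_le_numeral)
qed

end

section \<open>Prim's algorithm on groups of terminals\<close>

text \<open>\<open>K\<close> stands for the optimal cost. The optimal tree is represented only by
  the walk and the bound on distances that \<open>covering_walk\<close> extracts from it.\<close>

locale grouped_terminals = Metric_space V w for V :: "nat set" and w :: "nat \<Rightarrow> nat \<Rightarrow> real" +
  fixes T :: "nat set" and \<gamma> :: "nat \<Rightarrow> nat" and g :: nat and K :: real and walk :: "nat list"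
  assumes finite_T: "finite T"
    and group_less: "t \<in> T \<Longrightarrow> \<gamma> t < g"
    and diameter: "u \<in> T \<Longrightarrow> v \<in> T \<Longrightarrow> w u v \<le> K"
    and walk: "T \<subseteq> set walk" "set walk \<subseteq> V" "walk_length w walk \<le> 2 * K"
begin

lemmas metric = Metric_space_axioms

definition group :: "nat \<Rightarrow> nat set" where
  "group r = {t \<in> T. \<gamma> t = r}"

text \<open>The task left for group \<open>r\<close> once \<open>S\<close> is visited: for empty
  \<open>S\<close>, a connected graph on the group; for \<open>S\<close> the whole group,
  nothing.\<close>

definition connects :: "nat \<Rightarrow> nat set set \<Rightarrow> nat set \<Rightarrow> bool" where
  "connects r E S \<longleftrightarrow> E \<subseteq> {{u, v} |u v. u \<in> group r \<and> v \<in> group r} \<and>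
     group r \<times> group r \<subseteq> (contracted E S)\<^sup>*"

lemma finite_connects:
  assumes "connects r E S"
  shows "finite E"
proof (rule finite_subset)
  show "E \<subseteq> Pow T"
    using assms unfolding connects_def group_def by blast
qed (simp add: finite_T)

lemma connects_mono:
  assumes "connects r E S" "S \<subseteq> S'"
  shows "connects r E S'"
  using assms rtrancl_mono[OF contracted_mono[OF subset_refl assms(2)]]
  unfolding connects_def by blast

text \<open>Shortcutting the walk to the members of one group does not lengthen it and leaves a walk
  through exactly this group.\<close>

lemma ex_connects: "\<exists>E. connects r E {} \<and> weight w E \<le> 2 * K"
proof (intro exI conjI)
  let ?xs = "filter (\<lambda>x. x \<in> group r) walk"
  have set: "set ?xs = group r"
    using walk(1) by (auto simp: group_def)
  with walk_edges_ends[of _ ?xs]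
  have "walk_edges ?xs \<subseteq> {{u, v} |u v. u \<in> group r \<and> v \<in> group r}"
    by blast
  moreover have "group r \<times> group r \<subseteq> (contracted (walk_edges ?xs) {})\<^sup>*"
    using walk_edges_connect[of _ ?xs] unfolding set by blast
  ultimately show "connects r (walk_edges ?xs) {}"
    unfolding connects_def ..
  show "weight w (walk_edges ?xs) \<le> 2 * K"
    using weight_walk_edges_le[OF metric, of ?xs]
      walk_length_filter[OF metric walk(2), of "\<lambda>x. x \<in> group r"] walk(3) by linarith
qed

text \<open>On a path from \<open>s\<close> to \<open>x\<close>, the last edge leaving
  \<open>S\<close> weighs at least \<open>c\<close>. It may be dropped once \<open>x\<close> joins
  \<open>S\<close>: its outer end still reaches \<open>x\<close> without it, and \<open>x\<close> is
  now one point with its inner end.\<close>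

lemma connects_exchange:
  assumes conn: "connects r E S" and s: "s \<in> S" "s \<in> group r" and x: "x \<in> group r" "x \<notin> S"
    and min: "\<And>a b. a \<in> S \<inter> group r \<Longrightarrow> b \<in> group r - S \<Longrightarrow> c \<le> w a b"
  shows "\<exists>E'. connects r E' (insert x S) \<and> weight w E' + c \<le> weight w E"
proof -
  let ?R = "contracted E S"
  have E: "E \<subseteq> {{u, v} |u v. u \<in> group r \<and> v \<in> group r}" and R: "group r \<times> group r \<subseteq> ?R\<^sup>*"
    using conn by (auto simp: connects_def)
  have "(s, x) \<in> ?R\<^sup>*"
    using R s x by blast
  from rtrancl_last_crossing[OF this s(1) x(2)]
  obtain a b where ab: "a \<in> S" "b \<notin> S" "(a, b) \<in> ?R" "(b, x) \<in> (?R \<inter> (- S) \<times> (- S))\<^sup>*"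
    by blast
  have edge: "{a, b} \<in> E"
    using ab(2,3) by (auto simp: contracted_def)
  have "{a, b} \<in> {{u, v} |u v. u \<in> group r \<and> v \<in> group r}"
    using edge E by (rule subsetD[rotated])
  then have "a \<in> group r" "b \<in> group r"
    by (auto simp: doubleton_eq_iff)
  then have c: "c \<le> w a b"
    using ab by (intro min) auto
  define E' where "E' = E - {{a, b}}"
  let ?R' = "contracted E' (insert x S)"
  have R': "(y, z) \<in> ?R'" if "(y, z) \<in> ?R" "{y, z} \<noteq> {a, b}" for y z
    using that by (auto simp: contracted_def E'_def)
  have "?R \<inter> (- S) \<times> (- S) \<subseteq> ?R'"
    using R' ab(1) by (auto simp: doubleton_eq_iff)
  then have bx: "(b, x) \<in> ?R'\<^sup>*"
    using ab(4) rtrancl_mono by blast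
  have sym: "sym (?R'\<^sup>*)"
    by (intro sym_rtrancl sym_contracted)
  have "(x, a) \<in> ?R'"
    using ab(1) by (simp add: contracted_def)
  with bx have "(b, a) \<in> ?R'\<^sup>*"
    by (rule rtrancl_into_rtrancl)
  moreover from this have "(a, b) \<in> ?R'\<^sup>*"
    by (rule symD[OF sym])
  ultimately have "?R \<subseteq> ?R'\<^sup>*"
    using R' by (auto simp: doubleton_eq_iff)
  then have "?R\<^sup>* \<subseteq> ?R'\<^sup>*"
    by (rule rtrancl_subset_rtrancl)
  then have "connects r E' (insert x S)"
    using E R unfolding connects_def E'_def by blast
  moreover have "weight w E' + c \<le> weight w E"
    using weight_remove[OF metric finite_connects[OF conn] edge] c by (simp add: E'_def)
  ultimately show ?thesis
    by blast
qed

text \<open>\<open>E r\<close> is what remains to be paid for joining group \<open>r\<close> to its visited part.\<close>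

definition partial_tree :: "nat set \<Rightarrow> nat set set \<Rightarrow> bool" where
  "partial_tree S Es \<longleftrightarrow> S \<subseteq> T \<and> is_tree (S, Es) \<and>
     (\<exists>E. (\<forall>r<g. connects r (E r) (S \<inter> group r)) \<and>
       weight w Es + (\<Sum>r<g. weight w (E r)) \<le> 2 * real g * K + (real (card (\<gamma> ` S)) - 1) * K)"

lemma partial_tree_single:
  assumes "t \<in> T"
  shows "partial_tree {t} {}"
proof -
  obtain E where E: "\<And>r. connects r (E r) {}" "\<And>r. weight w (E r) \<le> 2 * K"
    using ex_connects by metis
  have "(\<Sum>r<g. weight w (E r)) \<le> (\<Sum>r<g. 2 * K)"
    by (intro sum_mono E)
  then have "weight w {} + (\<Sum>r<g. weight w (E r))
      \<le> 2 * real g * K + (real (card (\<gamma> ` {t})) - 1) * K"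
    by (simp add: weight_def[of _ "{}"])
  moreover have "connects r (E r) ({t} \<inter> group r)" for r
    by (rule connects_mono[OF E(1)]) simp
  ultimately show ?thesis
    unfolding partial_tree_def using assms is_tree_singleton[of t] by blast
qed

lemma partial_tree_extend:
  assumes pt: "partial_tree S Es" and u: "u \<in> S" and x: "x \<in> T" "x \<notin> S"
  shows "is_tree (insert x S, insert {u, x} Es)"
    "weight w (insert {u, x} Es) = w u x + weight w Es"
proof -
  have tree: "is_tree (S, Es)" and S: "S \<subseteq> T"
    using pt by (auto simp: partial_tree_def)
  show "is_tree (insert x S, insert {u, x} Es)"
    using is_tree_insert[OF tree u x(2)] .
  have simple: "simple_graph (S, Es)"
    using tree by (simp add: is_tree_def)
  have "{u, x} \<notin> Es"
    using simple_graph_edge[OF simple, of "{u, x}"] x(2) by auto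
  moreover have "finite Es"
    using finite_simple_graph[OF simple, of T] S finite_T by simp
  ultimately show "weight w (insert {u, x} Es) = w u x + weight w Es"
    using weight_insert[OF metric] by blast
qed

text \<open>\<open>connects_exchange\<close> refunds the price of the new edge, so the total does
  not grow. Minimality is required only within the group of \<open>x\<close>; hence distances
  between groups never have to be known.\<close>

lemma partial_tree_attach:
  assumes pt: "partial_tree S Es" and u: "u \<in> S" and x: "x \<in> T" "x \<notin> S" and same: "\<gamma> u = \<gamma> x"
    and min: "\<And>a b. a \<in> S \<Longrightarrow> b \<in> T - S \<Longrightarrow> \<gamma> a = \<gamma> x \<Longrightarrow> \<gamma> b = \<gamma> x \<Longrightarrow> w u x \<le> w a b"
  shows "partial_tree (insert x S) (insert {u, x} Es)"
proof -
  note extend = partial_tree_extend[OF pt u x]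
  obtain E where S: "S \<subseteq> T" and E: "\<And>r. r < g \<Longrightarrow> connects r (E r) (S \<inter> group r)"
    "weight w Es + (\<Sum>r<g. weight w (E r)) \<le> 2 * real g * K + (real (card (\<gamma> ` S)) - 1) * K"
    using pt by (auto simp: partial_tree_def)
  let ?r = "\<gamma> x"
  have r: "?r < g"
    using group_less x(1) .
  obtain E' where E': "connects ?r E' (insert x (S \<inter> group ?r))"
    "weight w E' + w u x \<le> weight w (E ?r)"
    using connects_exchange[OF E(1)[OF r], of u x "w u x"] u S x same min by (auto simp: group_def)
  have eq: "\<gamma> ` insert x S = \<gamma> ` S"
    using u same by (metis image_insert insert_absorb imageI)
  have split: "(\<Sum>r<g. f r) = f ?r + (\<Sum>r\<in>{..<g} - {?r}. f r)" for f :: "nat \<Rightarrow> real"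
    using r by (intro sum.remove) auto
  have "(\<Sum>r<g. weight w ((E(?r := E')) r)) + w u x \<le> (\<Sum>r<g. weight w (E r))"
    unfolding split using E'(2) by simp
  then have "weight w (insert {u, x} Es) + (\<Sum>r<g. weight w ((E(?r := E')) r))
      \<le> 2 * real g * K + (real (card (\<gamma> ` insert x S)) - 1) * K"
    unfolding extend(2) eq using E(2) by linarith
  moreover have "connects r ((E(?r := E')) r) (insert x S \<inter> group r)" if "r < g" for r
  proof (cases "r = ?r")
    case True
    then have "insert x S \<inter> group r = insert x (S \<inter> group r)"
      using x(1) by (auto simp: group_def)
    with E'(1) True show ?thesis by simp
  next
    case False
    then have "(E(?r := E')) r = E r"
      by simp
    moreover have "connects r (E r) (insert x S \<inter> group r)"
      by (rule connects_mono[OF E(1)[OF that]]) blast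
    ultimately show ?thesis
      by simp
  qed
  ultimately show ?thesis
    unfolding partial_tree_def using extend(1) S x(1) by blast
qed

text \<open>No exchange takes place: the \<open>K\<close> granted for one more entered group pays
  for an edge from any visited terminal.\<close>

lemma partial_tree_new_group:
  assumes pt: "partial_tree S Es" and u: "u \<in> S" and x: "x \<in> T" "x \<notin> S" and new: "\<gamma> x \<notin> \<gamma> ` S"
  shows "partial_tree (insert x S) (insert {u, x} Es)"
proof -
  note extend = partial_tree_extend[OF pt u x]
  obtain E where S: "S \<subseteq> T" and E: "\<And>r. r < g \<Longrightarrow> connects r (E r) (S \<inter> group r)"
    "weight w Es + (\<Sum>r<g. weight w (E r)) \<le> 2 * real g * K + (real (card (\<gamma> ` S)) - 1) * K"
    using pt by (auto simp: partial_tree_def)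
  have "finite S"
    using S finite_T finite_subset by blast
  then have card: "card (\<gamma> ` insert x S) = Suc (card (\<gamma> ` S))"
    using new by simp
  have "w u x \<le> K"
    using diameter u S x by blast
  then have "weight w (insert {u, x} Es) + (\<Sum>r<g. weight w (E r))
      \<le> 2 * real g * K + (real (card (\<gamma> ` insert x S)) - 1) * K"
    unfolding extend(2) card using E(2) by (simp add: algebra_simps)
  moreover have "connects r (E r) (insert x S \<inter> group r)" if "r < g" for r
    by (rule connects_mono[OF E(1)[OF that]]) blast
  ultimately show ?thesis
    unfolding partial_tree_def using extend(1) S x(1) by blast
qed

lemma partial_tree_complete:
  assumes "partial_tree T Es" "T \<subseteq> V"
  shows "steiner_tree V T (T, Es)" "cost w (T, Es) \<le> (3 * real g - 1) * K"
proof -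
  have tree: "is_tree (T, Es)"
    using assms(1) by (simp add: partial_tree_def)
  then show "steiner_tree V T (T, Es)"
    using assms(2) by (simp add: steiner_tree_def)
  obtain t where t: "t \<in> T"
    using tree by (auto simp: is_tree_def connected_graph_def)
  have "K \<ge> 0"
    using diameter[OF t t] nonneg[of t t] by linarith
  moreover have "card (\<gamma> ` T) \<le> card {..<g}"
    using group_less by (intro card_mono) auto
  ultimately have "(real (card (\<gamma> ` T)) - 1) * K \<le> (real g - 1) * K"
    by (intro mult_right_mono) auto
  moreover obtain E where
    "weight w Es + (\<Sum>r<g. weight w (E r)) \<le> 2 * real g * K + (real (card (\<gamma> ` T)) - 1) * K"
    using assms(1) by (auto simp: partial_tree_def)
  moreover have "(\<Sum>r<g. weight w (E r)) \<ge> 0"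
    by (intro sum_nonneg weight_nonneg[OF metric])
  ultimately show "cost w (T, Es) \<le> (3 * real g - 1) * K"
    unfolding cost_eq_weight by (simp add: algebra_simps)
qed

end

section \<open>Hoare triples with time and query budgets\<close>

text \<open>Total correctness with step and query budgets. The continuation \<open>cs\<close> and
  the left-over fuel \<open>f\<close> are quantified universally so that triples compose. Final
  state, step count and query list are fixed before the coin tape, so a triple also says that coins
  have no influence.\<close>

definition hoare :: "(nat \<Rightarrow> nat \<Rightarrow> real) \<Rightarrow> nat \<Rightarrow> (state \<Rightarrow> bool) \<Rightarrow> com \<Rightarrow> (state \<Rightarrow> bool) \<Rightarrow>
    nat \<Rightarrow> nat \<Rightarrow> bool" where
  "hoare w n P c Q t q \<longleftrightarrow> (\<forall>s. P s \<longrightarrow> (\<exists>s' t' qs. Q s' \<and> t' \<le> t \<and> length qs \<le> q \<and>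
     set qs \<subseteq> {..<n} \<times> {..<n} \<and>
     (\<forall>\<omega> cs f. result w (exec (t' + f) \<omega> (c # cs) s) = result w (exec f \<omega> cs s') \<and>
        queries w (exec (t' + f) \<omega> (c # cs) s) = qs @ queries w (exec f \<omega> cs s'))))"

lemma hoareE:
  assumes "hoare w n P c Q t q" "P s"
  obtains s' t' qs where "Q s'" "t' \<le> t" "length qs \<le> q" "set qs \<subseteq> {..<n} \<times> {..<n}"
    "\<And>\<omega> cs f. result w (exec (t' + f) \<omega> (c # cs) s) = result w (exec f \<omega> cs s')"
    "\<And>\<omega> cs f. queries w (exec (t' + f) \<omega> (c # cs) s) = qs @ queries w (exec f \<omega> cs s')"
  using assms unfolding hoare_def by blast

lemma hoare_consequence:
  assumes "hoare w n P c Q t q" "\<And>s. P' s \<Longrightarrow> P s" "\<And>s. Q s \<Longrightarrow> Q' s" "t \<le> t'" "q \<le> q'"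
  shows "hoare w n P' c Q' t' q'"
  unfolding hoare_def
proof (intro allI impI)
  fix s assume "P' s"
  from hoareE[OF assms(1) assms(2)[OF this]]
  obtain s' t0 qs where *: "Q s'" "t0 \<le> t" "length qs \<le> q" "set qs \<subseteq> {..<n} \<times> {..<n}"
    "\<And>\<omega> cs f. result w (exec (t0 + f) \<omega> (c # cs) s) = result w (exec f \<omega> cs s')"
    "\<And>\<omega> cs f. queries w (exec (t0 + f) \<omega> (c # cs) s) = qs @ queries w (exec f \<omega> cs s')"
    by blast
  show "\<exists>s' t0 qs. Q' s' \<and> t0 \<le> t' \<and> length qs \<le> q' \<and> set qs \<subseteq> {..<n} \<times> {..<n} \<and>
     (\<forall>\<omega> cs f. result w (exec (t0 + f) \<omega> (c # cs) s) = result w (exec f \<omega> cs s') \<and>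
        queries w (exec (t0 + f) \<omega> (c # cs) s) = qs @ queries w (exec f \<omega> cs s'))"
    using * assms(3-5) by (intro exI[of _ s'] exI[of _ t0] exI[of _ qs]) auto
qed

text \<open>This lets intermediate assertions mention values of the initial state; the invariant of
  the scan is parametrised by such values.\<close>

lemma hoare_state:
  assumes "\<And>s. P s \<Longrightarrow> hoare w n (\<lambda>s'. s' = s) c Q t q"
  shows "hoare w n P c Q t q"
  using assms unfolding hoare_def by blast

lemma hoare_Seq:
  assumes "hoare w n P c R t1 q1" "hoare w n R d Q t2 q2"
  shows "hoare w n P (Seq c d) Q (Suc (t1 + t2)) (q1 + q2)"
  unfolding hoare_def
proof (intro allI impI)
  fix s assume "P s"
  from hoareE[OF assms(1) this]
  obtain s1 u1 qs1 where 1: "R s1" "u1 \<le> t1" "length qs1 \<le> q1" "set qs1 \<subseteq> {..<n} \<times> {..<n}"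
    "\<And>\<omega> cs f. result w (exec (u1 + f) \<omega> (c # cs) s) = result w (exec f \<omega> cs s1)"
    "\<And>\<omega> cs f. queries w (exec (u1 + f) \<omega> (c # cs) s) = qs1 @ queries w (exec f \<omega> cs s1)"
    by blast
  from hoareE[OF assms(2) 1(1)]
  obtain s2 u2 qs2 where 2: "Q s2" "u2 \<le> t2" "length qs2 \<le> q2" "set qs2 \<subseteq> {..<n} \<times> {..<n}"
    "\<And>\<omega> cs f. result w (exec (u2 + f) \<omega> (d # cs) s1) = result w (exec f \<omega> cs s2)"
    "\<And>\<omega> cs f. queries w (exec (u2 + f) \<omega> (d # cs) s1) = qs2 @ queries w (exec f \<omega> cs s2)"
    by blast
  show "\<exists>s' t' qs. Q s' \<and> t' \<le> Suc (t1 + t2) \<and> length qs \<le> q1 + q2 \<and>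
     set qs \<subseteq> {..<n} \<times> {..<n} \<and>
     (\<forall>\<omega> cs f. result w (exec (t' + f) \<omega> (Seq c d # cs) s) = result w (exec f \<omega> cs s') \<and>
        queries w (exec (t' + f) \<omega> (Seq c d # cs) s) = qs @ queries w (exec f \<omega> cs s'))"
    using 1 2 by (intro exI[of _ s2] exI[of _ "Suc (u1 + u2)"] exI[of _ "qs1 @ qs2"])
      (simp add: add.assoc)
qed

text \<open>The invariant is indexed by the number of completed rounds, so the query budget may vary
  from round to round. In the step bound every round pays for its own test, and the additional step
  is the final failing test.\<close>

lemma hoare_While:
  assumes body: "\<And>j. j < m \<Longrightarrow> hoare w n (I j) c (I (Suc j)) t (q j)"
    and test: "\<And>j s. j \<le> m \<Longrightarrow> I j s \<Longrightarrow> bval s b \<longleftrightarrow> j < m"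
  shows "hoare w n (I 0) (While b c) (I m) (Suc (m * Suc t)) (\<Sum>j<m. q j)"
proof -
  \<comment> \<open>Induction on the number \<open>k\<close> of rounds still to come.\<close>
  have "\<exists>s' t' qs. I m s' \<and> t' \<le> Suc (k * Suc t) \<and> length qs \<le> (\<Sum>j\<in>{m - k..<m}. q j) \<and>
      set qs \<subseteq> {..<n} \<times> {..<n} \<and>
      (\<forall>\<omega> cs f. result w (exec (t' + f) \<omega> (While b c # cs) s) = result w (exec f \<omega> cs s') \<and>
         queries w (exec (t' + f) \<omega> (While b c # cs) s) = qs @ queries w (exec f \<omega> cs s'))"
    if "k \<le> m" "I (m - k) s" for k s
    using that
  proof (induction k arbitrary: s)
    case 0
    then have "\<not> bval s b"
      using test[of m s] by simp
    with 0 show ?case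
      by (intro exI[of _ s] exI[of _ 1] exI[of _ "[]"]) simp
  next
    case (Suc k)
    let ?j = "m - Suc k"
    have j: "?j < m" "Suc ?j = m - k"
      using Suc.prems by auto
    have b: "bval s b"
      using test[of ?j s] j Suc.prems by simp
    from hoareE[OF body[OF j(1)] Suc.prems(2)]
    obtain s1 u1 qs1 where 1: "I (Suc ?j) s1" "u1 \<le> t" "length qs1 \<le> q ?j"
      "set qs1 \<subseteq> {..<n} \<times> {..<n}"
      "\<And>\<omega> cs f. result w (exec (u1 + f) \<omega> (c # cs) s) = result w (exec f \<omega> cs s1)"
      "\<And>\<omega> cs f. queries w (exec (u1 + f) \<omega> (c # cs) s) = qs1 @ queries w (exec f \<omega> cs s1)"
      by blast
    have "k \<le> m" "I (m - k) s1"
      using 1(1) j Suc.prems(1) by auto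
    from Suc.IH[OF this]
    obtain s2 u2 qs2 where 2: "I m s2" "u2 \<le> Suc (k * Suc t)"
      "length qs2 \<le> (\<Sum>j\<in>{m - k..<m}. q j)" "set qs2 \<subseteq> {..<n} \<times> {..<n}"
      "\<And>\<omega> cs f. result w (exec (u2 + f) \<omega> (While b c # cs) s1) = result w (exec f \<omega> cs s2)"
      "\<And>\<omega> cs f. queries w (exec (u2 + f) \<omega> (While b c # cs) s1) = qs2 @ queries w (exec f \<omega> cs s2)"
      by blast
    have "(\<Sum>j\<in>{?j..<m}. q j) = q ?j + (\<Sum>j\<in>{m - k..<m}. q j)"
      using j by (simp add: sum.atLeast_Suc_lessThan)
    with 1 2 b show ?case
      by (intro exI[of _ s2] exI[of _ "Suc (u1 + u2)"] exI[of _ "qs1 @ qs2"])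
        (simp add: add.assoc)
  qed
  from this[of m] show ?thesis
    unfolding hoare_def by (simp add: atLeast0LessThan)
qed

section \<open>Symbolic execution of commands without loops and coin flips\<close>

primrec straight :: "com \<Rightarrow> bool" where
  "straight (NWrite a i x) = True"
| "straight (RWrite a i x) = True"
| "straight (Flip a i) = False"
| "straight (Dist a i x y) = True"
| "straight (PutVertex x) = True"
| "straight (PutEdge x y) = True"
| "straight (Seq c d) = (straight c \<and> straight d)"
| "straight (Cond b c d) = (straight c \<and> straight d)"
| "straight (While b c) = False"

text \<open>The branches of \<open>Cond\<close> are added, which gives a bound independent of the
  state. The clauses for \<open>Flip\<close> and \<open>While\<close> are placeholders, as they are
  in \<open>effect\<close> and \<open>asked\<close>.\<close>

primrec duration :: "com \<Rightarrow> nat" where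
  "duration (NWrite a i x) = 1"
| "duration (RWrite a i x) = 1"
| "duration (Flip a i) = 1"
| "duration (Dist a i x y) = 1"
| "duration (PutVertex x) = 1"
| "duration (PutEdge x y) = 1"
| "duration (Seq c d) = Suc (duration c + duration d)"
| "duration (Cond b c d) = Suc (duration c + duration d)"
| "duration (While b c) = 1"

primrec effect :: "(nat \<Rightarrow> nat \<Rightarrow> real) \<Rightarrow> com \<Rightarrow> state \<Rightarrow> state" where
  "effect w (NWrite a i x) s = nupd a (nval s i) (nval s x) s"
| "effect w (RWrite a i x) s = rupd a (nval s i) (rval s x) s"
| "effect w (Flip a i) s = s"
| "effect w (Dist a i x y) s = rupd a (nval s i) (w (nval s x) (nval s y)) s"
| "effect w (PutVertex x) s = s\<lparr>out := (insert (nval s x) (fst (out s)), snd (out s))\<rparr>"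
| "effect w (PutEdge x y) s =
     s\<lparr>out := (fst (out s), insert {nval s x, nval s y} (snd (out s)))\<rparr>"
| "effect w (Seq c d) s = effect w d (effect w c s)"
| "effect w (Cond b c d) s = (if bval s b then effect w c s else effect w d s)"
| "effect w (While b c) s = s"

primrec asked :: "(nat \<Rightarrow> nat \<Rightarrow> real) \<Rightarrow> com \<Rightarrow> state \<Rightarrow> (nat \<times> nat) list" where
  "asked w (NWrite a i x) s = []"
| "asked w (RWrite a i x) s = []"
| "asked w (Flip a i) s = []"
| "asked w (Dist a i x y) s = [(nval s x, nval s y)]"
| "asked w (PutVertex x) s = []"
| "asked w (PutEdge x y) s = []"
| "asked w (Seq c d) s = asked w c s @ asked w d (effect w c s)"
| "asked w (Cond b c d) s = (if bval s b then asked w c s else asked w d s)"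
| "asked w (While b c) s = []"

lemma exec_straight:
  assumes "straight c"
  shows "\<exists>t \<le> duration c. \<forall>\<omega> cs f. result w (exec (t + f) \<omega> (c # cs) s) = result w (exec f \<omega> cs (effect w c s)) \<and>
    queries w (exec (t + f) \<omega> (c # cs) s) = asked w c s @ queries w (exec f \<omega> cs (effect w c s))"
  using assms
proof (induction c arbitrary: s)
  case (Seq c d)
  from Seq.IH(1)[of s] Seq.prems obtain t1 where 1: "t1 \<le> duration c"
    "\<And>\<omega> cs f. result w (exec (t1 + f) \<omega> (c # cs) s) = result w (exec f \<omega> cs (effect w c s))"
    "\<And>\<omega> cs f. queries w (exec (t1 + f) \<omega> (c # cs) s) =
       asked w c s @ queries w (exec f \<omega> cs (effect w c s))"
    by auto
  from Seq.IH(2)[of "effect w c s"] Seq.prems obtain t2 where 2: "t2 \<le> duration d"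
    "\<And>\<omega> cs f. result w (exec (t2 + f) \<omega> (d # cs) (effect w c s)) =
       result w (exec f \<omega> cs (effect w d (effect w c s)))"
    "\<And>\<omega> cs f. queries w (exec (t2 + f) \<omega> (d # cs) (effect w c s)) =
       asked w d (effect w c s) @ queries w (exec f \<omega> cs (effect w d (effect w c s)))"
    by auto
  show ?case
    using 1 2 by (intro exI[of _ "Suc (t1 + t2)"]) (simp add: add.assoc)
next
  case (Cond b c d)
  show ?case
  proof (cases "bval s b")
    case True
    from Cond.IH(1)[of s] Cond.prems obtain t1 where "t1 \<le> duration c"
      "\<And>\<omega> cs f. result w (exec (t1 + f) \<omega> (c # cs) s) = result w (exec f \<omega> cs (effect w c s))"
      "\<And>\<omega> cs f. queries w (exec (t1 + f) \<omega> (c # cs) s) =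
         asked w c s @ queries w (exec f \<omega> cs (effect w c s))"
      by auto
    with True show ?thesis
      by (intro exI[of _ "Suc t1"]) simp
  next
    case False
    from Cond.IH(2)[of s] Cond.prems obtain t1 where "t1 \<le> duration d"
      "\<And>\<omega> cs f. result w (exec (t1 + f) \<omega> (d # cs) s) = result w (exec f \<omega> cs (effect w d s))"
      "\<And>\<omega> cs f. queries w (exec (t1 + f) \<omega> (d # cs) s) =
         asked w d s @ queries w (exec f \<omega> cs (effect w d s))"
      by auto
    with False show ?thesis
      by (intro exI[of _ "Suc t1"]) simp
  qed
qed (rule exI[of _ "1::nat"], simp)+

lemma hoare_straight:
  assumes "straight c"
    "\<And>s. P s \<Longrightarrow> Q (effect w c s) \<and> set (asked w c s) \<subseteq> {..<n} \<times> {..<n} \<and> length (asked w c s) \<le> q"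
  shows "hoare w n P c Q (duration c) q"
  unfolding hoare_def
proof (intro allI impI)
  fix s assume "P s"
  with exec_straight[OF assms(1), of w s] assms(2)[of s]
  show "\<exists>s' t' qs. Q s' \<and> t' \<le> duration c \<and> length qs \<le> q \<and> set qs \<subseteq> {..<n} \<times> {..<n} \<and>
     (\<forall>\<omega> cs f. result w (exec (t' + f) \<omega> (c # cs) s) = result w (exec f \<omega> cs s') \<and>
        queries w (exec (t' + f) \<omega> (c # cs) s) = qs @ queries w (exec f \<omega> cs s'))"
    by blast
qed

text \<open>With fuel covering the step budget the machine reaches the empty command list, which
  answers \<open>Some\<close>; so the run cannot time out.\<close>

lemma hoare_exec:
  assumes "hoare w n (\<lambda>s'. s' = s) c Q t q" "t \<le> f"
  shows "\<exists>s'. Q s' \<and> (\<forall>\<omega>. result w (exec f \<omega> [c] s) = Some (out s')) \<and>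
    (\<forall>\<omega>. set (queries w (exec f \<omega> [c] s)) \<subseteq> {..<n} \<times> {..<n} \<and> length (queries w (exec f \<omega> [c] s)) \<le> q)"
proof -
  from hoareE[OF assms(1) refl]
  obtain s' t' qs where *: "Q s'" "t' \<le> t" "length qs \<le> q" "set qs \<subseteq> {..<n} \<times> {..<n}"
    "\<And>\<omega> cs f. result w (exec (t' + f) \<omega> (c # cs) s) = result w (exec f \<omega> cs s')"
    "\<And>\<omega> cs f. queries w (exec (t' + f) \<omega> (c # cs) s) = qs @ queries w (exec f \<omega> cs s')"
    by blast
  obtain f' where "f = t' + f'"
    using *(2) assms(2) by (metis le_add_diff_inverse order_trans)
  then show ?thesis
    using * by (intro exI[of _ s']) simp
qed

section \<open>The algorithm as a program\<close>

text \<open>Arrays of natural numbers: 2 marks visited terminals, 3 holds one plus the nearest visited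
  terminal of the same group (0 if there is none) and 4 the group; the scalars are 5 (number of
  visited terminals), 6 (loop counter), 7 (last visited terminal), 8 and 9 (one plus the best and one
  plus some unvisited terminal). Arrays of reals: 0 holds the distance to the nearest visited
  terminal of the group, and 1 the last query answer. Terminals are represented by their indices.\<close>

abbreviation scalar :: "nat \<Rightarrow> nexp" where
  "scalar a \<equiv> NRead a (NConst 0)"

abbreviation assign :: "nat \<Rightarrow> nexp \<Rightarrow> com" where
  "assign a x \<equiv> NWrite a (NConst 0) x"

abbreviation skip :: com where
  "skip \<equiv> assign 10 (NConst 0)"

text \<open>The machine has no remainder operation: an index \<open>i \<ge> g\<close> copies its
  group from \<open>i - g\<close>.\<close>

definition group_step :: "nat \<Rightarrow> com" where
  "group_step g =
     Seq (Cond (NLess (scalar 6) (NConst g))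
            (NWrite 4 (scalar 6) (scalar 6))
            (NWrite 4 (scalar 6) (NRead 4 (NSub (scalar 6) (NConst g)))))
         (assign 6 (NAdd (scalar 6) (NConst 1)))"

definition start :: com where
  "start =
     Seq (PutVertex (NRead 1 (NConst 0)))
    (Seq (NWrite 2 (NConst 0) (NConst 1))
         (assign 5 (NConst 1)))"

definition round_start :: com where
  "round_start = Seq (assign 6 (NConst 0)) (Seq (assign 8 (NConst 0)) (assign 9 (NConst 0)))"

text \<open>Only the terminal visited last can change a nearest visited neighbour, so only its
  distances are asked, and only within its group. Equality of groups is tested by two
  comparisons.\<close>

definition relax :: com where
  "relax =
     Cond (BAnd (BNot (NLess (NRead 4 (scalar 6)) (NRead 4 (scalar 7))))
                (BNot (NLess (NRead 4 (scalar 7)) (NRead 4 (scalar 6)))))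
       (Seq (Dist 1 (NConst 0) (NRead 1 (scalar 7)) (NRead 1 (scalar 6)))
         (Cond (BAnd (NLess (NConst 0) (NRead 3 (scalar 6)))
                     (BNot (RLess (RRead 1 (NConst 0)) (RRead 0 (scalar 6)))))
           skip
           (Seq (RWrite 0 (scalar 6) (RRead 1 (NConst 0)))
                (NWrite 3 (scalar 6) (NAdd (scalar 7) (NConst 1))))))
       skip"

definition select :: com where
  "select =
     Cond (BAnd (NLess (NConst 0) (NRead 3 (scalar 6)))
                (BNot (BAnd (NLess (NConst 0) (scalar 8))
                            (BNot (RLess (RRead 0 (scalar 6))
                                         (RRead 0 (NSub (scalar 8) (NConst 1))))))))
       (assign 8 (NAdd (scalar 6) (NConst 1)))
       skip"

definition scan_step :: com where
  "scan_step =
     Seq (Cond (NLess (NConst 0) (NRead 2 (scalar 6)))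
            skip
            (Seq relax (Seq select (assign 9 (NAdd (scalar 6) (NConst 1))))))
         (assign 6 (NAdd (scalar 6) (NConst 1)))"

text \<open>If no candidate has a visited member in its group, a new group is entered from the
  terminal with index 0: the 1 written to array 3 is one plus this index.\<close>

definition round_end :: com where
  "round_end =
     Seq (Cond (NLess (NConst 0) (scalar 8))
            skip
            (Seq (assign 8 (scalar 9))
                 (NWrite 3 (NSub (scalar 8) (NConst 1)) (NConst 1))))
    (Seq (assign 7 (NSub (scalar 8) (NConst 1)))
    (Seq (NWrite 2 (scalar 7) (NConst 1))
    (Seq (PutVertex (NRead 1 (scalar 7)))
    (Seq (PutEdge (NRead 1 (NSub (NRead 3 (scalar 7)) (NConst 1))) (NRead 1 (scalar 7)))
         (assign 5 (NAdd (scalar 5) (NConst 1)))))))"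

definition steiner_program :: "nat \<Rightarrow> com" where
  "steiner_program g =
     Seq (While (NLess (scalar 6) (NRead 0 (NConst 1))) (group_step g))
    (Seq start
         (While (NLess (scalar 5) (NRead 0 (NConst 1)))
           (Seq round_start
           (Seq (While (NLess (scalar 6) (NRead 0 (NConst 1))) scan_step)
                round_end))))"

section \<open>Invariants of the run and their preservation\<close>

lemma narr_nupd [simp]: "narr (nupd a i x s) = (narr s)(a := (narr s a)(i := x))"
  and rarr_nupd [simp]: "rarr (nupd a i x s) = rarr s"
  and out_nupd [simp]: "out (nupd a i x s) = out s"
  and narr_rupd [simp]: "narr (rupd a i y s) = narr s"
  and rarr_rupd [simp]: "rarr (rupd a i y s) = (rarr s)(a := (rarr s a)(i := y))"
  and out_rupd [simp]: "out (rupd a i y s) = out s"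
  by (simp_all add: nupd_def rupd_def)

text \<open>Indices in one residue class have different quotients by \<open>g\<close>. These lie
  between 0 and \<open>(k - 1) div g\<close>, and the quotient of \<open>c\<close> itself is not
  taken.\<close>

lemma card_other_members_le:
  fixes g :: nat
  assumes "c < k" "g > 0"
  shows "(\<Sum>j<k. of_bool (j \<noteq> c \<and> j mod g = c mod g)) \<le> (k - 1) div g"
proof -
  let ?J = "{j. j < k \<and> j \<noteq> c \<and> j mod g = c mod g}"
  have "card ?J \<le> card ({..(k - 1) div g} - {c div g})"
  proof (rule card_inj_on_le)
    have "x = y" if "x mod g = y mod g" "x div g = y div g" for x y
      using that by (metis div_mult_mod_eq)
    then show "inj_on (\<lambda>j. j div g) ?J" and "(\<lambda>j. j div g) ` ?J \<subseteq> {..(k - 1) div g} - {c div g}"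
      by (auto simp: inj_on_def intro!: div_le_mono)
  qed simp
  also have "\<dots> = (k - 1) div g"
    using assms by (simp add: div_le_mono)
  finally show ?thesis
    by (simp add: Int_def lessThan_def)
qed

locale steiner_run = grouped_terminals "{..<n}" w T \<gamma> g K walk
  for n w T \<gamma> g K walk +
  fixes k :: nat and t :: "nat \<Rightarrow> nat"
  assumes t: "bij_betw t {..<k} T" and group_t: "i < k \<Longrightarrow> \<gamma> (t i) = i mod g"
    and k_pos: "k > 0" and g_pos: "g > 0" and T_subset: "T \<subseteq> {..<n}"
begin

definition base :: "state \<Rightarrow> bool" where
  "base s \<longleftrightarrow> narr s 0 1 = k \<and> (\<forall>i<k. narr s 1 i = t i)"

definition grouping :: "nat \<Rightarrow> state \<Rightarrow> bool" where
  "grouping j s \<longleftrightarrow> base s \<and> narr s 6 0 = j \<and> (\<forall>i<j. narr s 4 i = i mod g) \<and>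
     (\<forall>i. narr s 2 i = 0 \<and> narr s 3 i = 0) \<and> narr s 7 0 = 0 \<and> out s = ({}, {})"

definition visited :: "state \<Rightarrow> nat set" where
  "visited s = {i. i < k \<and> narr s 2 i \<noteq> 0}"

definition peers :: "nat set \<Rightarrow> nat \<Rightarrow> nat set" where
  "peers S i = {u \<in> S. u mod g = i mod g}"

definition nearest :: "state \<Rightarrow> nat set \<Rightarrow> nat \<Rightarrow> bool" where
  "nearest s U i \<longleftrightarrow> U = {} \<and> narr s 3 i = 0 \<or>
     (\<exists>u \<in> U. narr s 3 i = Suc u \<and> rarr s 0 i = w (t u) (t i) \<and>
       (\<forall>v \<in> U. w (t u) (t i) \<le> w (t v) (t i)))"

definition common :: "nat \<Rightarrow> state \<Rightarrow> bool" where
  "common r s \<longleftrightarrow> base s \<and> (\<forall>i<k. narr s 4 i = i mod g) \<and> narr s 5 0 = r"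

text \<open>The terminal visited last is left out of \<open>nearest\<close>, because its distances
  are asked only in the following round.\<close>

definition rounds :: "nat \<Rightarrow> state \<Rightarrow> bool" where
  "rounds r s \<longleftrightarrow> common r s \<and> card (visited s) = r \<and> 0 \<in> visited s \<and> narr s 7 0 \<in> visited s \<and>
     (\<forall>i<k. i \<notin> visited s \<longrightarrow> nearest s (peers (visited s) i - {narr s 7 0}) i) \<and>
     fst (out s) = t ` visited s \<and> partial_tree (t ` visited s) (snd (out s))"

text \<open>\<open>S\<close>, \<open>c\<close>, \<open>r\<close> and \<open>G\<close> freeze the
  situation at the start of the round. Indices below \<open>j\<close> have already taken
  \<open>c\<close> into account, the others have not; cells 8 and 9 concern only indices below
  \<open>j\<close>.\<close>

definition scanning :: "nat set \<Rightarrow> nat \<Rightarrow> nat \<Rightarrow> graph \<Rightarrow> nat \<Rightarrow> state \<Rightarrow> bool" where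
  "scanning S c r G j s \<longleftrightarrow> common r s \<and> visited s = S \<and> narr s 7 0 = c \<and> out s = G \<and>
     narr s 6 0 = j \<and>
     (\<forall>i<k. i \<notin> S \<longrightarrow> nearest s (peers S i - (if i < j then {} else {c})) i) \<and>
     (narr s 9 0 = 0 \<and> (\<forall>i<j. i \<in> S) \<or> (\<exists>b<j. narr s 9 0 = Suc b \<and> b \<notin> S)) \<and>
     (narr s 8 0 = 0 \<and> (\<forall>i<j. i \<notin> S \<longrightarrow> narr s 3 i = 0) \<or>
      (\<exists>b<j. narr s 8 0 = Suc b \<and> b \<notin> S \<and> narr s 3 b \<noteq> 0 \<and>
        (\<forall>i<j. i \<notin> S \<longrightarrow> narr s 3 i \<noteq> 0 \<longrightarrow> rarr s 0 b \<le> rarr s 0 i)))"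

lemma nearest_cong:
  assumes "narr s' 3 i = narr s 3 i" "rarr s' 0 i = rarr s 0 i"
  shows "nearest s' U i = nearest s U i"
  using assms by (simp add: nearest_def)

lemma t_less: "i < k \<Longrightarrow> t i < n"
  using t T_subset by (auto simp: bij_betw_def)

lemma hoare_grouping:
  "hoare w n (grouping 0) (While (NLess (scalar 6) (NRead 0 (NConst 1))) (group_step g)) (grouping k)
     (Suc (k * Suc (duration (group_step g)))) 0"
proof -
  have "hoare w n (grouping 0) (While (NLess (scalar 6) (NRead 0 (NConst 1))) (group_step g))
      (grouping k) (Suc (k * Suc (duration (group_step g)))) (\<Sum>j<k. 0)"
  proof (rule hoare_While)
    fix j assume "j < k"
    show "hoare w n (grouping j) (group_step g) (grouping (Suc j)) (duration (group_step g)) 0"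
    proof (rule hoare_straight)
      fix s assume s: "grouping j s"
      then have "(if j < g then j else narr s 4 (j - g)) = j mod g"
        using g_pos by (simp add: grouping_def le_mod_geq)
      with s show "grouping (Suc j) (effect w (group_step g) s) \<and>
          set (asked w (group_step g) s) \<subseteq> {..<n} \<times> {..<n} \<and> length (asked w (group_step g) s) \<le> 0"
        by (auto simp: group_step_def grouping_def base_def less_Suc_eq split: if_splits)
    qed (simp add: group_step_def)
  qed (auto simp: grouping_def base_def)
  then show ?thesis by simp
qed

lemma hoare_start: "hoare w n (grouping k) start (rounds 1) (duration start) 0"
proof (rule hoare_straight)
  fix s assume s: "grouping k s"
  let ?s = "effect w start s"
  have "t 0 \<in> T"
    using t k_pos by (auto simp: bij_betw_def)
  then have "partial_tree {t 0} {}"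
    by (rule partial_tree_single)
  moreover have "visited ?s = {0}"
    using s k_pos by (auto simp: visited_def start_def grouping_def)
  moreover have "nearest ?s (peers {0} i - {0}) i" for i
    using s by (auto simp: nearest_def peers_def start_def grouping_def)
  moreover have "common 1 ?s" "narr ?s 7 0 = 0" "out ?s = ({t 0}, {})"
    using s k_pos by (auto simp: common_def base_def start_def grouping_def)
  ultimately show "rounds 1 ?s \<and> set (asked w start s) \<subseteq> {..<n} \<times> {..<n} \<and>
      length (asked w start s) \<le> 0"
    by (simp add: rounds_def start_def)
qed (simp add: start_def)

lemma relax_nearest:
  assumes s: "common r s" "narr s 6 0 = j" "narr s 7 0 = c" and j: "j < k" "c < k" "c \<in> S"
    and near: "nearest s (peers S j - {c}) j"
  shows "nearest (effect w relax s) (peers S j) j"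
proof (cases "j mod g = c mod g")
  case False
  then have "peers S j - {c} = peers S j"
    by (auto simp: peers_def)
  moreover have "j mod g < c mod g \<or> c mod g < j mod g"
    using False by linarith
  then have "effect w relax s = nupd 10 0 0 s"
    using s j by (auto simp: relax_def common_def)
  ultimately show ?thesis
    using near by (simp add: nearest_def)
next
  case True
  define U where "U = peers S j - {c}"
  have U: "peers S j = insert c U"
    using True j by (auto simp: U_def peers_def)
  have ids: "narr s 1 c = t c" "narr s 1 j = t j" "narr s 4 c = c mod g" "narr s 4 j = c mod g"
    using s(1) j True by (auto simp: common_def base_def)
  show ?thesis
  proof (cases "U = {}")
    case True
    with near have "narr s 3 j = 0"
      unfolding U_def[symmetric] nearest_def by simp
    with True ids s show ?thesis
      unfolding U by (simp add: relax_def nearest_def)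
  next
    case False
    with near obtain u where u: "u \<in> U" "narr s 3 j = Suc u" "rarr s 0 j = w (t u) (t j)"
      "\<forall>v \<in> U. w (t u) (t j) \<le> w (t v) (t j)"
      unfolding U_def[symmetric] nearest_def by auto
    show ?thesis
    proof (cases "w (t c) (t j) < w (t u) (t j)")
      case True
      with u(4) have "\<forall>v \<in> U. w (t c) (t j) \<le> w (t v) (t j)"
        by force
      with True u ids s show ?thesis
        unfolding U by (simp add: relax_def nearest_def)
    next
      case False
      with u ids s show ?thesis
        unfolding U by (auto simp: relax_def nearest_def)
    qed
  qed
qed

lemma relax_frame:
  assumes "narr s 6 0 = j"
  shows "a \<noteq> 3 \<Longrightarrow> a \<noteq> 10 \<Longrightarrow> narr (effect w relax s) a = narr s a"
    and "i \<noteq> j \<Longrightarrow> narr (effect w relax s) 3 i = narr s 3 i"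
    and "i \<noteq> j \<Longrightarrow> rarr (effect w relax s) 0 i = rarr s 0 i"
    and "out (effect w relax s) = out s"
  using assms by (simp_all add: relax_def)

text \<open>A queried \<open>j\<close> is unvisited whereas \<open>c\<close> is visited, so
  \<open>j \<noteq> c\<close>. This exclusion is what brings the count per round down to
  \<open>(k - 1) div g\<close>.\<close>

lemma asked_scan_step:
  assumes s: "scanning S c r G j s" and j: "j < k" "c < k" "c \<in> S"
  shows "set (asked w scan_step s) \<subseteq> {..<n} \<times> {..<n}"
    and "length (asked w scan_step s) \<le> of_bool (j \<noteq> c \<and> j mod g = c mod g)"
proof -
  have "0 < narr s 2 j \<longleftrightarrow> j \<in> S"
    using s j(1) by (auto simp: scanning_def visited_def)
  moreover have "narr s 1 j = t j" "narr s 1 c = t c" "narr s 4 j = j mod g" "narr s 4 c = c mod g"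
    "narr s 6 0 = j" "narr s 7 0 = c"
    using s j by (auto simp: scanning_def common_def base_def)
  ultimately have "asked w scan_step s = (if j \<notin> S \<and> j mod g = c mod g then [(t c, t j)] else [])"
    using neq_iff[of "j mod g" "c mod g"] by (simp add: scan_step_def relax_def select_def)
  moreover have "t c < n" "t j < n"
    using t_less j by auto
  ultimately show "set (asked w scan_step s) \<subseteq> {..<n} \<times> {..<n}"
    and "length (asked w scan_step s) \<le> of_bool (j \<noteq> c \<and> j mod g = c mod g)"
    using j(3) by auto
qed

lemma scanning_scan_step:
  assumes s: "scanning S c r G j s" and j: "j < k" "c < k" "c \<in> S"
  shows "scanning S c r G (Suc j) (effect w scan_step s)"
proof (cases "j \<in> S")
  case True
  then have "0 < narr s 2 j"
    using s by (auto simp: scanning_def visited_def)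
  moreover have j6: "narr s 6 0 = j"
    using s by (simp add: scanning_def)
  ultimately have eff: "effect w scan_step s = nupd 6 0 (Suc j) (nupd 10 0 0 s)"
    by (simp add: scan_step_def)
  have near: "nearest (effect w scan_step s) U i = nearest s U i" for U i
    unfolding eff by (rule nearest_cong) simp_all
  have "visited (effect w scan_step s) = visited s" "common r (effect w scan_step s) = common r s"
    unfolding eff by (simp_all add: visited_def common_def base_def)
  with s True show ?thesis
    unfolding scanning_def near unfolding eff by (auto simp: less_Suc_eq)
next
  case False
  define s1 where "s1 = effect w relax s"
  define s2 where "s2 = effect w select s1"
  have s2_9: "effect w scan_step s = nupd 6 0 (Suc j) (nupd 9 0 (Suc j) s2)"
  proof -
    have "narr s 2 j = 0" "narr s 6 0 = j"
      using s j(1) False by (auto simp: scanning_def visited_def)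
    moreover from this have "narr s2 6 0 = j"
      using relax_frame(1)[of s j 6] by (simp add: s2_def s1_def select_def)
    ultimately show ?thesis
      by (simp add: scan_step_def s1_def[symmetric] s2_def[symmetric])
  qed
  have c: "common r s" "visited s = S" "narr s 7 0 = c" "out s = G" "narr s 6 0 = j"
    and near: "\<And>i. i < k \<Longrightarrow> i \<notin> S \<Longrightarrow> nearest s (peers S i - (if i < j then {} else {c})) i"
    and best: "narr s 8 0 = 0 \<and> (\<forall>i<j. i \<notin> S \<longrightarrow> narr s 3 i = 0) \<or>
      (\<exists>b<j. narr s 8 0 = Suc b \<and> b \<notin> S \<and> narr s 3 b \<noteq> 0 \<and>
        (\<forall>i<j. i \<notin> S \<longrightarrow> narr s 3 i \<noteq> 0 \<longrightarrow> rarr s 0 b \<le> rarr s 0 i))"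
    using s unfolding scanning_def by blast+
  note frame = relax_frame[OF c(5), folded s1_def]
  have s1: "narr s1 a = narr s a" if "a \<in> {0, 1, 2, 4, 5, 6, 7, 8}" for a
    using that by (intro frame(1)) auto
  have "nearest s (peers S j - {c}) j"
    using near[of j] j False by simp
  from relax_nearest[OF c(1,5,3) j this] have near_j: "nearest s1 (peers S j) j"
    by (simp add: s1_def)
  have near1: "nearest s1 (peers S i - (if i < Suc j then {} else {c})) i" if "i < k" "i \<notin> S" for i
  proof (cases "i = j")
    case True
    with near_j show ?thesis by simp
  next
    case False
    have "nearest s1 U i = nearest s U i" for U
      by (rule nearest_cong) (simp_all add: frame False)
    with near[OF that] False show ?thesis
      by (simp add: less_Suc_eq)
  qed
  have best1: "narr s1 8 0 = 0 \<and> (\<forall>i<j. i \<notin> S \<longrightarrow> narr s1 3 i = 0) \<or>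
      (\<exists>b<j. narr s1 8 0 = Suc b \<and> b \<notin> S \<and> narr s1 3 b \<noteq> 0 \<and>
        (\<forall>i<j. i \<notin> S \<longrightarrow> narr s1 3 i \<noteq> 0 \<longrightarrow> rarr s1 0 b \<le> rarr s1 0 i))"
    using best by (simp add: s1 frame less_imp_neq cong: conj_cong imp_cong)
  have s2: "narr s2 a = narr s1 a" if "a \<noteq> 8" "a \<noteq> 10" for a
    using that by (simp add: s2_def select_def)
  have s2': "rarr s2 = rarr s1" "out s2 = out s1"
    by (simp_all add: s2_def select_def)
  have best2: "narr s2 8 0 = 0 \<and> (\<forall>i<Suc j. i \<notin> S \<longrightarrow> narr s1 3 i = 0) \<or>
      (\<exists>b<Suc j. narr s2 8 0 = Suc b \<and> b \<notin> S \<and> narr s1 3 b \<noteq> 0 \<and>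
        (\<forall>i<Suc j. i \<notin> S \<longrightarrow> narr s1 3 i \<noteq> 0 \<longrightarrow> rarr s1 0 b \<le> rarr s1 0 i))"
  proof -
    have s6: "narr s1 6 0 = j"
      using s1[of 6] c(5) by simp
    from best1 consider
      (none) "narr s1 8 0 = 0" "\<forall>i<j. i \<notin> S \<longrightarrow> narr s1 3 i = 0"
      | (some) b where "b < j" "narr s1 8 0 = Suc b" "b \<notin> S" "narr s1 3 b \<noteq> 0"
        "\<forall>i<j. i \<notin> S \<longrightarrow> narr s1 3 i \<noteq> 0 \<longrightarrow> rarr s1 0 b \<le> rarr s1 0 i"
      by metis
    then show ?thesis
    proof cases
      case none
      then show ?thesis
        using s6 False by (cases "narr s1 3 j = 0") (auto simp: s2_def select_def less_Suc_eq)
    next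
      case some
      show ?thesis
      proof (cases "narr s1 3 j \<noteq> 0 \<and> rarr s1 0 j < rarr s1 0 b")
        case True
        then have "narr s2 8 0 = Suc j"
          using some s6 by (simp add: s2_def select_def)
        moreover have "rarr s1 0 j \<le> rarr s1 0 i" if "i < Suc j" "i \<notin> S" "narr s1 3 i \<noteq> 0" for i
          using that some(5) True by (auto simp: less_Suc_eq)
        ultimately show ?thesis
          using True False by blast
      next
        case no: False
        then have "narr s2 8 0 = Suc b"
          using some s6 by (auto simp: s2_def select_def)
        moreover have "rarr s1 0 b \<le> rarr s1 0 i" if "i < Suc j" "i \<notin> S" "narr s1 3 i \<noteq> 0" for i
          using that some(5) no by (auto simp: less_Suc_eq)
        ultimately show ?thesis
          using some by (meson less_SucI)
      qed
    qed
  qed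
  have "nearest (effect w scan_step s) U i = nearest s1 U i" for U i
    by (rule nearest_cong) (simp_all add: s2_9 s2 s2')
  moreover have "visited (effect w scan_step s) = visited s"
    "common r (effect w scan_step s) = common r s"
    by (simp_all add: s2_9 s2 s1 visited_def common_def base_def)
  ultimately show ?thesis
    unfolding scanning_def using c near1 best2 False
    by (auto simp: s2_9 s2 s2' s1 frame)
qed

lemma hoare_scanning:
  assumes "c < k" "c \<in> S"
  shows "hoare w n (scanning S c r G 0) (While (NLess (scalar 6) (NRead 0 (NConst 1))) scan_step)
    (scanning S c r G k) (Suc (k * Suc (duration scan_step))) ((k - 1) div g)"
proof (rule hoare_consequence)
  show "hoare w n (scanning S c r G 0) (While (NLess (scalar 6) (NRead 0 (NConst 1))) scan_step)
    (scanning S c r G k) (Suc (k * Suc (duration scan_step)))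
    (\<Sum>j<k. of_bool (j \<noteq> c \<and> j mod g = c mod g))"
  proof (rule hoare_While)
    fix j assume "j < k"
    show "hoare w n (scanning S c r G j) scan_step (scanning S c r G (Suc j)) (duration scan_step)
        (of_bool (j \<noteq> c \<and> j mod g = c mod g))"
    proof (rule hoare_straight)
      fix s assume "scanning S c r G j s"
      note * = this \<open>j < k\<close> assms
      show "scanning S c r G (Suc j) (effect w scan_step s) \<and>
          set (asked w scan_step s) \<subseteq> {..<n} \<times> {..<n} \<and>
          length (asked w scan_step s) \<le> of_bool (j \<noteq> c \<and> j mod g = c mod g)"
        by (intro conjI scanning_scan_step[OF *] asked_scan_step[OF *])
    qed (simp add: scan_step_def relax_def select_def)
  qed (auto simp: scanning_def common_def base_def)
qed (use card_other_members_le assms(1) g_pos in auto)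

text \<open>The choice of the program meets the hypotheses of \<open>partial_tree_attach\<close> or,
  if cell 8 is empty, of \<open>partial_tree_new_group\<close>. The selected pair is nearest among
  the pairs of all groups, which includes minimality within its own group.\<close>

lemma rounds_round_end:
  assumes s0: "rounds r s0" "r < k"
    and s: "scanning (visited s0) (narr s0 7 0) r (out s0) k s"
  shows "rounds (Suc r) (effect w round_end s)"
proof -
  define S where "S = visited s0"
  define s' where "s' = effect w round_end s"
  have S: "S \<subseteq> {..<k}" "card S = r" "0 \<in> S" "partial_tree (t ` S) (snd (out s0))"
    "fst (out s0) = t ` S"
    using s0 by (auto simp: rounds_def S_def visited_def)
  have c: "common r s" "visited s = S" "out s = out s0"
    and near: "\<And>i. i < k \<Longrightarrow> i \<notin> S \<Longrightarrow> nearest s (peers S i) i"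
    and other: "narr s 9 0 = 0 \<and> (\<forall>i<k. i \<in> S) \<or> (\<exists>b<k. narr s 9 0 = Suc b \<and> b \<notin> S)"
    and best: "narr s 8 0 = 0 \<and> (\<forall>i<k. i \<notin> S \<longrightarrow> narr s 3 i = 0) \<or>
      (\<exists>b<k. narr s 8 0 = Suc b \<and> b \<notin> S \<and> narr s 3 b \<noteq> 0 \<and>
        (\<forall>i<k. i \<notin> S \<longrightarrow> narr s 3 i \<noteq> 0 \<longrightarrow> rarr s 0 b \<le> rarr s 0 i))"
    using s unfolding scanning_def S_def by auto
  have ids: "\<And>i. i < k \<Longrightarrow> narr s 1 i = t i" "narr s 5 0 = r"
    using c(1) by (auto simp: common_def base_def)
  have inj: "t i = t j \<longleftrightarrow> i = j" if "i < k" "j < k" for i j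
    using t that by (auto simp: bij_betw_def inj_on_def)
  have tT: "t i \<in> T" if "i < k" for i
    using t that by (auto simp: bij_betw_def)
  have notin: "t x \<notin> t ` S" if "x < k" "x \<notin> S" for x
    using that S(1) inj by auto
  obtain x u where x: "x < k" "x \<notin> S" "u \<in> S"
    and eff: "narr s' 7 0 = x" "narr s' 2 = (narr s 2)(x := 1)"
      "\<And>i. i \<noteq> x \<Longrightarrow> narr s' 3 i = narr s 3 i" "rarr s' = rarr s"
      "narr s' 0 = narr s 0" "narr s' 1 = narr s 1" "narr s' 4 = narr s 4" "narr s' 5 0 = Suc r"
      "out s' = (insert (t x) (t ` S), insert {t u, t x} (snd (out s0)))"
    and tree: "partial_tree (insert (t x) (t ` S)) (insert {t u, t x} (snd (out s0)))"
  proof (cases "narr s 8 0 = 0")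
    case True
    \<comment> \<open>Since \<open>r < k\<close>, some terminal is unvisited, so cell 9 holds
      one.\<close>
    have "\<not> (\<forall>i<k. i \<in> S)"
    proof
      assume "\<forall>i<k. i \<in> S"
      then have "card {..<k} \<le> card S"
        using S(1) finite_subset by (intro card_mono) auto
      then show False
        using S(2) s0(2) by simp
    qed
    with other obtain x where x: "x < k" "narr s 9 0 = Suc x" "x \<notin> S"
      by blast
    have "narr s 3 i = 0" if "i < k" "i \<notin> S" for i
      using best True that by auto
    then have "peers S x = {}"
      using near[of x] x by (auto simp: nearest_def)
    then have "i mod g \<noteq> x mod g" if "i \<in> S" for i
      using that by (auto simp: peers_def)
    moreover have "\<gamma> (t i) = i mod g" if "i \<in> S" for i
      using that S(1) by (intro group_t) auto
    ultimately have "\<gamma> (t x) \<noteq> \<gamma> (t i)" if "i \<in> S" for i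
      using that group_t[OF x(1)] by metis
    then have "\<gamma> (t x) \<notin> \<gamma> ` t ` S"
      by blast
    then have "partial_tree (insert (t x) (t ` S)) (insert {t 0, t x} (snd (out s0)))"
      using S(3) x tT notin by (intro partial_tree_new_group[OF S(4)]) auto
    moreover have "narr s 1 x = t x" "narr s 1 0 = t 0"
      using ids x k_pos by auto
    ultimately show thesis
      using x(1,3) S(3,5) True x(2) ids(2) c(3)
      by (intro that[of x 0]) (simp_all add: s'_def round_end_def)
  next
    case False
    with best obtain x where x: "x < k" "narr s 8 0 = Suc x" "x \<notin> S" "narr s 3 x \<noteq> 0"
      and min: "\<And>i. i < k \<Longrightarrow> i \<notin> S \<Longrightarrow> narr s 3 i \<noteq> 0 \<Longrightarrow> rarr s 0 x \<le> rarr s 0 i"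
      by auto
    obtain u where u: "u \<in> peers S x" "narr s 3 x = Suc u" "rarr s 0 x = w (t u) (t x)"
      using near[OF x(1,3)] x(4) by (auto simp: nearest_def)
    have uS: "u \<in> S" "u < k" "u mod g = x mod g"
      using u(1) S(1) by (auto simp: peers_def)
    have "w (t u) (t x) \<le> w a b" if ab: "a \<in> t ` S" "b \<in> T - t ` S" "\<gamma> a = \<gamma> (t x)" "\<gamma> b = \<gamma> (t x)" for a b
    proof -
      obtain i where i: "i \<in> S" "a = t i" "i < k"
        using ab(1) S(1) by auto
      obtain j where j: "j < k" "b = t j" "j \<notin> S"
        using ab(2) t by (auto simp: bij_betw_def)
      \<comment> \<open>Two comparisons lead from \<open>(i, j)\<close> to the selected pair:
        \<open>nearest\<close> at \<open>j\<close> optimises the visited end, the choice of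
        \<open>x\<close> the unvisited one.\<close>
      have "i \<in> peers S j"
        using i j ab(3,4) group_t by (simp add: peers_def)
      with near[OF j(1,3)] have "narr s 3 j \<noteq> 0" "rarr s 0 j \<le> w (t i) (t j)"
        by (auto simp: nearest_def)
      with min[OF j(1,3)] show ?thesis
        using i j u(3) by simp
    qed
    then have "partial_tree (insert (t x) (t ` S)) (insert {t u, t x} (snd (out s0)))"
      using uS x tT notin group_t by (intro partial_tree_attach[OF S(4)]) auto
    moreover have "narr s 1 x = t x" "narr s 1 u = t u"
      using ids x uS by auto
    ultimately show thesis
      using x u(2) uS S(5) ids(2) c(3)
      by (intro that[of x u]) (simp_all add: s'_def round_end_def)
  qed
  have vis: "visited s' = insert x S"
    using c(2) x(1) by (auto simp: visited_def eff(2))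
  have "nearest s' (peers (insert x S) i - {x}) i" if "i < k" "i \<notin> insert x S" for i
  proof -
    \<comment> \<open>\<open>x\<close> is now the terminal visited last and thus exempt, so the
      table of nearest neighbours is valid unchanged.\<close>
    have "peers (insert x S) i - {x} = peers S i"
      using x(2) by (auto simp: peers_def)
    moreover have "nearest s' (peers S i) i = nearest s (peers S i) i"
      by (rule nearest_cong) (use that eff in auto)
    ultimately show ?thesis
      using near that by auto
  qed
  moreover have "common (Suc r) s'"
    using c(1) eff(5-8) by (simp add: common_def base_def)
  moreover have "card (insert x S) = Suc r"
    using S(2) x(2) finite_subset[OF S(1)] by simp
  ultimately show ?thesis
    unfolding s'_def[symmetric] rounds_def vis using eff(1,9) tree S(3) by auto
qed

lemma hoare_program:
  "hoare w n (grouping 0) (steiner_program g) (rounds k) (100 * k\<^sup>2) ((k - 1) * ((k - 1) div g))"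
proof -
  let ?test = "\<lambda>a. NLess (scalar a) (NRead 0 (NConst 1))"
  let ?scan = "While (?test 6) scan_step"
  let ?round = "Seq round_start (Seq ?scan round_end)"
  define d where "d = Suc (duration round_start + Suc (Suc (k * Suc (duration scan_step)) + duration round_end))"
  have "hoare w n (rounds r) ?round (rounds (Suc r)) d ((k - 1) div g)" if r: "r < k" for r
  proof (rule hoare_state)
    fix s0 assume s0: "rounds r s0"
    let ?S = "visited s0" and ?c = "narr s0 7 0"
    have c: "?c < k" "?c \<in> ?S"
      using s0 by (auto simp: rounds_def visited_def)
    have "hoare w n (\<lambda>s. s = s0) round_start (scanning ?S ?c r (out s0) 0) (duration round_start) 0"
      by (rule hoare_straight)
        (use s0 in \<open>auto simp: round_start_def scanning_def rounds_def common_def base_def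
            visited_def nearest_def\<close>)
    moreover have "hoare w n (scanning ?S ?c r (out s0) k) round_end (rounds (Suc r)) (duration round_end) 0"
      by (rule hoare_straight)
        (use rounds_round_end[OF s0 r] in \<open>auto simp: round_end_def\<close>)
    ultimately show "hoare w n (\<lambda>s. s = s0) ?round (rounds (Suc r)) d ((k - 1) div g)"
      using hoare_Seq[OF _ hoare_Seq[OF hoare_scanning[OF c, of r "out s0"]]]
      unfolding d_def by fastforce
  qed
  \<comment> \<open>The count begins at 1 because \<open>start\<close> has already visited one
    terminal; \<open>k - 1\<close> rounds remain.\<close>
  then have "hoare w n (rounds (Suc 0)) (While (?test 5) ?round) (rounds (Suc (k - 1)))
      (Suc ((k - 1) * Suc d)) (\<Sum>j<k - 1. (k - 1) div g)"
    by (intro hoare_While[where I = "\<lambda>j. rounds (Suc j)"])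
      (auto simp: rounds_def common_def base_def)
  then have loop: "hoare w n (rounds 1) (While (?test 5) ?round) (rounds k)
      (Suc ((k - 1) * Suc d)) ((k - 1) * ((k - 1) div g))"
    using k_pos by simp
  show ?thesis
    unfolding steiner_program_def
  proof (rule hoare_consequence[OF hoare_Seq[OF hoare_grouping hoare_Seq[OF hoare_start loop]]])
    have "k \<le> k\<^sup>2" "1 \<le> k\<^sup>2"
      using k_pos by (simp_all add: power2_eq_square)
    moreover have "(k - 1) * Suc d \<le> k * Suc d"
      by (rule mult_le_mono1) simp
    \<comment> \<open>A scan step is allotted 19 steps and its loop test one more, whence the
      20.\<close>
    moreover have "Suc d \<le> 20 * k + 30"
      by (simp add: d_def round_start_def scan_step_def relax_def select_def round_end_def)
    then have "k * Suc d \<le> k * (20 * k + 30)"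
      by (rule mult_le_mono2)
    then have "k * Suc d \<le> 20 * k\<^sup>2 + 30 * k"
      by (simp add: algebra_simps power2_eq_square)
    moreover have "duration (group_step g) = 5" "duration start = 5"
      by (simp_all add: group_step_def start_def)
    ultimately show "Suc (Suc (k * Suc (duration (group_step g))) +
        Suc (duration start + Suc ((k - 1) * Suc d))) \<le> 100 * k\<^sup>2"
      by simp
  qed auto
qed

end

section \<open>From the verified program to the upper bound\<close>

lemma ex_tree:
  assumes "finite S" "S \<noteq> {}"
  shows "\<exists>E. is_tree (S, E)"
  using assms
proof (induction rule: finite_ne_induct)
  case (singleton x)
  show ?case
    using is_tree_singleton by blast
next
  case (insert x S)
  then show ?case
    using is_tree_insert by (metis ex_in_conv)
qed

lemma grouping_input:
  assumes "steiner_run n w T \<gamma> g K walk (card T) ((!) (sorted_list_of_set T))"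
  shows "steiner_run.grouping g (card T) ((!) (sorted_list_of_set T)) 0 (input n T)"
  using assms by (simp add: steiner_run.grouping_def steiner_run.base_def input_def)

lemma steiner_program_correct:
  fixes \<alpha> :: real and T :: "nat set"
  assumes \<alpha>: "3 * real g - 1 \<le> \<alpha>" and g: "g > 0" and T: "T \<subseteq> {..<n}" "T \<noteq> {}"
    and w: "Metric_space {..<n} w"
  defines "D \<equiv> \<lambda>\<omega>. exec (100 * n\<^sup>2) \<omega> [steiner_program g] (input n T)"
  shows "\<exists>G. approx_steiner_tree \<alpha> {..<n} T w G \<and> (\<forall>\<omega>. result w (D \<omega>) = Some G)"
    and "set (queries w (D \<omega>)) \<subseteq> {..<n} \<times> {..<n}"
    and "length (queries w (D \<omega>)) \<le> (card T - 1) * ((card T - 1) div g)"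
proof -
  let ?V = "{..<n}" and ?K = "ST {..<n} T w"
  define k where "k = card T"
  define t where "t = (!) (sorted_list_of_set T)"
  \<comment> \<open>The group of a terminal is its position in the sorted list modulo
    \<open>g\<close>, the number that \<open>group_step\<close> computes.\<close>
  define \<gamma> where "\<gamma> v = inv_into {..<k} t v mod g" for v
  have fin: "finite T"
    using T(1) finite_subset by blast
  have t: "bij_betw t {..<k} T"
    using fin bij_betw_nth[of "sorted_list_of_set T" "{..<k}" T] by (simp add: t_def k_def)
  have k: "k > 0" "k \<le> n"
    using fin T card_mono[of ?V T] by (auto simp: k_def card_gt_0_iff)
  obtain E where "is_tree (T, E)"
    using ex_tree[OF fin T(2)] by blast
  then have "steiner_tree ?V T (T, E)"
    using T(1) by (simp add: steiner_tree_def)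
  from ST_attained[OF finite_lessThan this]
  obtain G where G: "steiner_tree ?V T G" "cost w G = ?K" .
  have G': "connected_graph G" "simple_graph G" "fst G \<subseteq> ?V" "T \<subseteq> fst G"
    using G(1) by (auto simp: steiner_tree_def is_tree_def)
  from covering_walk[OF w G'(1,2) finite_subset[OF G'(3) finite_lessThan] G'(3)]
  obtain walk where walk: "set walk = fst G" "walk_length w walk \<le> 2 * ?K"
    "\<forall>u \<in> fst G. \<forall>v \<in> fst G. w u v \<le> ?K"
    unfolding G(2) by blast
  have "grouped_terminals ?V w T \<gamma> g ?K walk"
  proof (intro grouped_terminals.intro grouped_terminals_axioms.intro)
    show "\<gamma> v < g" for v
      using g by (simp add: \<gamma>_def)
    show "w u v \<le> ?K" if "u \<in> T" "v \<in> T" for u v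
      using that G'(4) walk(3) by blast
  qed (use w fin walk G' in auto)
  moreover have "\<gamma> (t i) = i mod g" if "i < k" for i
    using that t by (simp add: \<gamma>_def bij_betw_def)
  ultimately have run: "steiner_run n w T \<gamma> g ?K walk k t"
    using t k(1) g T(1) by (intro steiner_run.intro steiner_run_axioms.intro) auto
  interpret steiner_run n w T \<gamma> g ?K walk k t
    by (rule run)
  have "grouping 0 (input n T)"
    using grouping_input[of n w T \<gamma> g ?K walk] run by (simp add: k_def t_def)
  then have run_hoare: "hoare w n (\<lambda>s. s = input n T) (steiner_program g) (rounds k) (100 * k\<^sup>2)
      ((k - 1) * ((k - 1) div g))"
    by (intro hoare_consequence[OF hoare_program]) auto
  have "100 * k\<^sup>2 \<le> 100 * n\<^sup>2"
    using k(2) by (simp add: power_mono)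
  from hoare_exec[OF run_hoare this] obtain s where s: "rounds k s" "\<And>\<omega>. result w (D \<omega>) = Some (out s)"
    and q: "\<And>\<omega>. set (queries w (D \<omega>)) \<subseteq> ?V \<times> ?V"
      "\<And>\<omega>. length (queries w (D \<omega>)) \<le> (k - 1) * ((k - 1) div g)"
    unfolding D_def by blast
  show "set (queries w (D \<omega>)) \<subseteq> ?V \<times> ?V"
    and "length (queries w (D \<omega>)) \<le> (card T - 1) * ((card T - 1) div g)"
    using q by (auto simp: k_def)
  \<comment> \<open>After round \<open>k\<close> as many terminals are visited as there are.\<close>
  have "visited s = {..<k}"
    using s(1) by (intro card_subset_eq) (auto simp: rounds_def visited_def)
  then have "fst (out s) = T" "partial_tree T (snd (out s))"
    using s(1) t by (auto simp: rounds_def bij_betw_def)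
  then have out: "out s = (T, snd (out s))" "partial_tree T (snd (out s))"
    by (auto simp: prod_eq_iff)
  have "(3 * real g - 1) * ?K \<le> \<alpha> * ?K"
    using \<alpha> cost_nonneg[OF w, of G] G(2) by (intro mult_right_mono) auto
  then have "approx_steiner_tree \<alpha> ?V T w (out s)"
    using partial_tree_complete[OF out(2) T(1)] out(1) unfolding approx_steiner_tree_def by simp
  with s(2) show "\<exists>G. approx_steiner_tree \<alpha> ?V T w G \<and> (\<forall>\<omega>. result w (D \<omega>) = Some G)"
    by blast
qed

text \<open>\<open>\<alpha> \<ge> 2\<close> makes \<open>(\<alpha> + 1) / 3\<close> at least 1, so
  there is a group. Rounding down loses less than 1, whence
  \<open>\<alpha> \<le> 3 * g + 2 \<le> 6 * g\<close>; this is the origin of the 6.\<close>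

lemma query_bound:
  fixes \<alpha> :: real
  assumes "\<alpha> \<ge> 2" "g = nat \<lfloor>(\<alpha> + 1) / 3\<rfloor>"
  shows "g > 0" "3 * real g - 1 \<le> \<alpha>" "real ((k - 1) * ((k - 1) div g)) \<le> 6 * (real k ^ 2 / \<alpha>)"
proof -
  define x where "x = (\<alpha> + 1) / 3"
  have "1 \<le> x"
    using assms(1) by (simp add: x_def)
  then have g: "g > 0" "real g \<le> x" "x - 1 < real g"
    using assms(2) unfolding x_def[symmetric] by linarith+
  then show "g > 0" "3 * real g - 1 \<le> \<alpha>"
    by (simp_all add: x_def)
  have "\<alpha> = 3 * x - 1"
    by (simp add: x_def field_simps)
  also have "\<dots> \<le> 3 * (real g + 1) - 1"
    using g(3) by simp
  also have "\<dots> \<le> 6 * real g"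
    using g(1) by simp
  finally have "\<alpha> \<le> 6 * real g" .
  then have "\<alpha> / 6 \<le> real g"
    by simp
  have "real ((k - 1) div g) \<le> real (k - 1) / real g"
    by (rule of_nat_div_le_of_nat)
  also have "\<dots> \<le> real k / (\<alpha> / 6)"
    using \<open>\<alpha> / 6 \<le> real g\<close> assms(1) by (intro frac_le) auto
  finally have "real (k - 1) * real ((k - 1) div g) \<le> real k * (real k / (\<alpha> / 6))"
    by (intro mult_mono) auto
  then show "real ((k - 1) * ((k - 1) div g)) \<le> 6 * (real k ^ 2 / \<alpha>)"
    by (simp add: power2_eq_square mult_ac)
qed

lemma prob_space_fair_coins: "prob_space fair_coins"
  unfolding fair_coins_def by (intro prob_space_PiM measure_pmf.prob_space_axioms)

text \<open>The run ignores the coins, so the success event is the whole space and has probability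
  1. The logarithmic factor appears with exponent 0.\<close>

lemma query_upper_bound:
  fixes \<alpha> c :: real
  assumes \<alpha>: "\<alpha> \<ge> 2"
  shows "\<exists>(P::com) (a::nat) (b::nat). \<forall>(n::nat) (T::nat set) (w::nat \<Rightarrow> nat \<Rightarrow> real).
     T \<subseteq> {..<n} \<longrightarrow> T \<noteq> {} \<longrightarrow> Metric_space {..<n} w \<longrightarrow>
     (let k = card T; A = (\<lambda>\<omega>. exec (a * n ^ b) \<omega> [P] (input n T)) in
       (\<forall>\<omega>. result w (A \<omega>) \<noteq> None \<and>
            set (queries w (A \<omega>)) \<subseteq> {..<n} \<times> {..<n} \<and>
            real (length (queries w (A \<omega>))) \<le> 6 * (real k ^ 2 / \<alpha>) * (1 + ln (real k)) ^ 0) \<and>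
       measure fair_coins {\<omega> \<in> space fair_coins. succeeds \<alpha> {..<n} T w (A \<omega>)}
         \<ge> 1 - real n powr (- c))"
proof -
  define g where "g = nat \<lfloor>(\<alpha> + 1) / 3\<rfloor>"
  note g = query_bound[OF \<alpha> g_def]
  show ?thesis
  proof (intro exI allI impI)
    fix n :: nat and T w
    assume T: "T \<subseteq> {..<n}" "T \<noteq> {}" and w: "Metric_space {..<n} w"
    let ?A = "\<lambda>\<omega>. exec (100 * n\<^sup>2) \<omega> [steiner_program g] (input n T)"
    note correct = steiner_program_correct[OF g(2,1) T w]
    obtain G where G: "approx_steiner_tree \<alpha> {..<n} T w G" "\<And>\<omega>. result w (?A \<omega>) = Some G"
      using correct(1) by blast
    have "real (length (queries w (?A \<omega>))) \<le> 6 * (real (card T) ^ 2 / \<alpha>)" for \<omega>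
      using correct(3)[of \<omega>] g(3)[of "card T"] by linarith
    moreover have "{\<omega> \<in> space fair_coins. succeeds \<alpha> {..<n} T w (?A \<omega>)} = space fair_coins"
      using G by (auto simp: succeeds_def)
    ultimately show "let k = card T; A = ?A in
       (\<forall>\<omega>. result w (A \<omega>) \<noteq> None \<and>
            set (queries w (A \<omega>)) \<subseteq> {..<n} \<times> {..<n} \<and>
            real (length (queries w (A \<omega>))) \<le> 6 * (real k ^ 2 / \<alpha>) * (1 + ln (real k)) ^ 0) \<and>
       measure fair_coins {\<omega> \<in> space fair_coins. succeeds \<alpha> {..<n} T w (A \<omega>)}
         \<ge> 1 - real n powr (- c)"
      using correct(2) G(2) prob_space.prob_space[OF prob_space_fair_coins]
      by (simp add: Let_def)
  qed
qed

section \<open>The lower bound\<close>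

text \<open>Orient the edges of a connected graph along shortest paths towards a root.\<close>

lemma connected_graph_parents:
  assumes "connected_graph G" "r \<in> fst G"
  shows "\<exists>p. (\<forall>u \<in> fst G - {r}. {u, p u} \<in> snd G) \<and> inj_on (\<lambda>u. {u, p u}) (fst G - {r})"
proof -
  define R where "R = {(x, y). {x, y} \<in> snd G}"
  define dst where "dst u = (LEAST n. (r, u) \<in> R ^^ n)" for u
  have "\<exists>y. {u, y} \<in> snd G \<and> dst y < dst u" if u: "u \<in> fst G - {r}" for u
  proof -
    have "(r, u) \<in> R\<^sup>*"
      using assms u unfolding connected_graph_def R_def by blast
    then have "\<exists>n. (r, u) \<in> R ^^ n"
      by (simp add: rtrancl_power)
    then have d: "(r, u) \<in> R ^^ dst u"
      unfolding dst_def by (rule LeastI_ex)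
    moreover have "dst u \<noteq> 0"
      using d u by (cases "dst u = 0") auto
    ultimately obtain n y where y: "dst u = Suc n" "(r, y) \<in> R ^^ n" "(y, u) \<in> R"
      by (cases "dst u") auto
    have "dst y \<le> n"
      unfolding dst_def using y(2) by (rule Least_le)
    then show ?thesis
      using y by (auto simp: R_def insert_commute)
  qed
  then obtain p where p: "\<And>u. u \<in> fst G - {r} \<Longrightarrow> {u, p u} \<in> snd G \<and> dst (p u) < dst u"
    by metis
  \<comment> \<open>If two vertices shared an edge, each would be the parent of the other and
    \<open>dst\<close> would decrease in both directions.\<close>
  have "inj_on (\<lambda>u. {u, p u}) (fst G - {r})"
  proof (rule inj_onI)
    fix u v assume uv: "u \<in> fst G - {r}" "v \<in> fst G - {r}" "{u, p u} = {v, p v}"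
    show "u = v"
      using p[OF uv(1)] p[OF uv(2)] uv(3) by (auto simp: doubleton_eq_iff)
  qed
  with p show ?thesis by blast
qed

text \<open>One fixed choice that depends on \<open>r\<close> and \<open>G\<close> alone, so
  labellings that lead to the same output also have the same parents.\<close>

definition parent :: "nat \<Rightarrow> graph \<Rightarrow> nat \<Rightarrow> nat" where
  "parent r G = (SOME p. (\<forall>u \<in> fst G - {r}. {u, p u} \<in> snd G) \<and>
     inj_on (\<lambda>u. {u, p u}) (fst G - {r}))"

lemma parent:
  assumes "connected_graph G" "r \<in> fst G"
  shows "u \<in> fst G - {r} \<Longrightarrow> {u, parent r G u} \<in> snd G"
    and "inj_on (\<lambda>u. {u, parent r G u}) (fst G - {r})"
  using someI_ex[OF connected_graph_parents[OF assms]] by (auto simp: parent_def)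

section \<open>Cluster metrics and the cost of their Steiner trees\<close>

definition cluster_metric :: "nat set \<Rightarrow> real \<Rightarrow> (nat \<Rightarrow> nat) \<Rightarrow> nat \<Rightarrow> nat \<Rightarrow> real" where
  "cluster_metric T L l x y =
     (if x = y then 0 else if x \<in> T \<and> y \<in> T \<and> l x = l y then 1 else L)"

text \<open>A violation would need two sides of length at most 1 against a third of length
  \<open>L\<close>, but having equal labels is transitive.\<close>

lemma Metric_space_cluster_metric:
  assumes "L \<ge> 1"
  shows "Metric_space M (cluster_metric T L l)"
proof
  fix x y z
  define P where "P x y \<longleftrightarrow> x \<in> T \<and> y \<in> T \<and> l x = l y" for x y
  have metric: "cluster_metric T L l x y = (if x = y then 0 else if P x y then 1 else L)" for x y
    unfolding cluster_metric_def P_def ..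
  have "\<not> P x y \<or> \<not> P y z \<or> P x z"
    unfolding P_def by metis
  then show "cluster_metric T L l x z \<le> cluster_metric T L l x y + cluster_metric T L l y z"
    using assms unfolding metric
    by (cases "x = y"; cases "y = z"; cases "P x y"; cases "P y z") simp_all
  show "0 \<le> cluster_metric T L l x y"
    using assms unfolding metric by simp
  show "(cluster_metric T L l x y = 0) = (x = y)"
    using assms unfolding metric by simp
  show "cluster_metric T L l x y = cluster_metric T L l y x"
  proof -
    have "P x y = P y x" "(x = y) = (y = x)"
      unfolding P_def by metis+
    then show ?thesis
      unfolding metric by simp
  qed
qed

text \<open>Terminals are attached one at a time, to one with the same label if possible; only the
  first terminal of each label may need an edge of length \<open>L\<close>.\<close>

lemma ST_cluster_metric_le:
  assumes "T \<subseteq> {..<n}" "T \<noteq> {}" "L \<ge> 1"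
  shows "ST {..<n} T (cluster_metric T L l) \<le> real (card T) + real (card (l ` T)) * L"
proof -
  have fin: "finite T"
    using assms(1) finite_subset by blast
  have "\<exists>E. is_tree (S, E) \<and>
      cost (cluster_metric T L l) (S, E) \<le> real (card S) + real (card (l ` S)) * L"
    if "finite S" "S \<noteq> {}" "S \<subseteq> T" for S
    using that
  proof (induction rule: finite_ne_induct)
    case (singleton x)
    then show ?case
      using is_tree_singleton[of x] assms(3) by (intro exI[of _ "{}"]) (simp add: cost_def)
  next
    case (insert x S)
    then obtain E where E: "is_tree (S, E)"
      "cost (cluster_metric T L l) (S, E) \<le> real (card S) + real (card (l ` S)) * L"
      by auto
    obtain a where a: "a \<in> S" "l x \<in> l ` S \<Longrightarrow> l a = l x"
      using insert.hyps(2) by (metis ex_in_conv imageE)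
    have "finite E"
      using finite_simple_graph[of "(S, E)" S] E(1) insert.hyps by (auto simp: is_tree_def)
    moreover have "{a, x} \<notin> E"
      using E(1) insert.hyps(3) simple_graph_edge[of "(S, E)" "{a, x}"] by (auto simp: is_tree_def)
    ultimately have "cost (cluster_metric T L l) (insert x S, insert {a, x} E) =
        cost (cluster_metric T L l) (S, E) + cluster_metric T L l a x"
      using cost_insert[OF Metric_space_cluster_metric[OF assms(3)]] by blast
    moreover have "cluster_metric T L l a x \<le> 1 + (if l x \<in> l ` S then 0 else L)"
      using a insert.prems assms(3) by (auto simp: cluster_metric_def)
    ultimately have "cost (cluster_metric T L l) (insert x S, insert {a, x} E) \<le>
        real (card (insert x S)) + real (card (l ` insert x S)) * L"
      using E(2) insert.hyps by (auto simp: card_insert_if algebra_simps split: if_splits)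
    with is_tree_insert[OF E(1) a(1) insert.hyps(3)] show ?case
      by blast
  qed
  from this[OF fin assms(2) subset_refl] obtain E where "is_tree (T, E)"
    "cost (cluster_metric T L l) (T, E) \<le> real (card T) + real (card (l ` T)) * L"
    by blast
  moreover from this(1) have "steiner_tree {..<n} T (T, E)"
    using assms(1) by (simp add: steiner_tree_def)
  ultimately show ?thesis
    using ST_le[of "{..<n}" T "(T, E)"] order_trans by blast
qed

text \<open>Excluding \<open>u\<close> matters at the root, where \<open>parent\<close> is
  unconstrained: the label of the parent must not move along with the label of
  \<open>u\<close>.\<close>

definition joined :: "nat set \<Rightarrow> nat \<Rightarrow> graph option \<Rightarrow> (nat \<Rightarrow> nat) \<Rightarrow> nat \<Rightarrow> bool" where
  "joined T r res l u \<longleftrightarrow> (\<exists>G. res = Some G \<and> parent r G u \<in> T - {u} \<and> l (parent r G u) = l u)"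

text \<open>Edges to parents are distinct, and each one costs \<open>L\<close> unless its child is
  \<open>joined\<close>. The root has no such edge, hence the 1.\<close>

lemma cost_cluster_metric_ge:
  assumes G: "steiner_tree {..<n} T G" and "r \<in> T" "L \<ge> 1"
  shows "cost (cluster_metric T L l) G \<ge>
    L * (real (card T) - 1 - real (card {u \<in> T. joined T r (Some G) l u}))"
proof -
  let ?w = "cluster_metric T L l" and ?p = "parent r G"
  let ?B = "{u \<in> T. joined T r (Some G) l u}"
  let ?U = "T - {r} - ?B"
  have conn: "connected_graph G" "simple_graph G" and T: "T \<subseteq> fst G" "r \<in> fst G"
    and finT: "finite T" and fin: "finite (snd G)"
    using G assms(2) finite_subset[of T "{..<n}"] finite_simple_graph[of G "{..<n}"]
    by (auto simp: steiner_tree_def is_tree_def)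
  have w: "?w (Min {u, v}) (Max {u, v}) = ?w u v" for u v
    by (rule edge_weight) (auto simp: cluster_metric_def)
  have edge: "{u, ?p u} \<in> snd G" if "u \<in> ?U" for u
    using that parent(1)[OF conn(1) T(2)] T(1) by blast
  have inj: "inj_on (\<lambda>u. {u, ?p u}) ?U"
    by (rule inj_on_subset[OF parent(2)[OF conn(1) T(2)]]) (use T(1) in blast)
  have wL: "?w u (?p u) = L" if "u \<in> ?U" for u
  proof -
    have "u \<noteq> ?p u"
      using edge[OF that] conn(2) by (auto simp: simple_graph_def doubleton_eq_iff)
    then show ?thesis
      using that by (auto simp: cluster_metric_def joined_def)
  qed
  have "card T \<le> card ?U + card ?B + 1"
  proof -
    have "T \<subseteq> ?U \<union> ?B \<union> {r}" by blast
    then have "card T \<le> card (?U \<union> ?B \<union> {r})"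
      using finT by (intro card_mono) auto
    also have "\<dots> \<le> card (?U \<union> ?B) + card {r}"
      by (rule card_Un_le)
    also have "\<dots> \<le> card ?U + card ?B + 1"
      using card_Un_le[of ?U ?B] by simp
    finally show ?thesis .
  qed
  then have "L * (real (card T) - 1 - real (card ?B)) \<le> L * real (card ?U)"
    using assms(3) by (intro mult_left_mono) auto
  also have "\<dots> = (\<Sum>u\<in>?U. ?w u (?p u))"
    using wL by simp
  also have "\<dots> = (\<Sum>u\<in>?U. ?w (Min {u, ?p u}) (Max {u, ?p u}))"
    by (simp only: w)
  also have "\<dots> = (\<Sum>e\<in>(\<lambda>u. {u, ?p u}) ` ?U. ?w (Min e) (Max e))"
    by (simp only: sum.reindex[OF inj] o_def)
  also have "\<dots> \<le> cost ?w G"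
    unfolding cost_def using edge fin assms(3)
    by (intro sum_mono2) (auto simp: cluster_metric_def)
  finally show ?thesis .
qed

section \<open>Counting labels along a decision tree and averaging over labellings\<close>

definition touching :: "nat \<Rightarrow> (nat \<times> nat) list \<Rightarrow> nat" where
  "touching u qs = length (filter (\<lambda>(x, y). x = u \<or> y = u) qs)"

text \<open>All labels of \<open>u\<close> that have not yet been named by a query touching \<open>u\<close> follow the same branch
  of the decision tree, and every query touching \<open>u\<close> removes at most one label from this branch.\<close>

lemma joined_labels_le:
  fixes L :: real and l :: "nat \<Rightarrow> nat" and lab :: "nat \<Rightarrow> nat \<Rightarrow> nat"
  assumes "finite C" "u \<in> T"
    and lab: "\<And>c. lab c u = c" "\<And>c v. v \<noteq> u \<Longrightarrow> lab c v = l v"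
  defines "w \<equiv> \<lambda>c. cluster_metric T L (lab c)"
  shows "card {c \<in> C. joined T r (result (w c) A) (lab c) u} * card C
    \<le> card C + 2 * (\<Sum>c\<in>C. touching u (queries (w c) A))"
  using assms(1)
proof (induction A arbitrary: C)
  case (Answer res)
  have "card {c \<in> C. joined T r res (lab c) u} \<le> 1"
  proof (cases res)
    case None
    then show ?thesis by (simp add: joined_def)
  next
    case (Some G)
    \<comment> \<open>At a leaf the output is fixed, hence also the parent of \<open>u\<close> and
      the label of this parent.\<close>
    have "{c \<in> C. joined T r res (lab c) u} \<subseteq> {l (parent r G u)}"
      using Some by (auto simp: joined_def lab)
    from card_mono[OF _ this] show ?thesis
      by simp
  qed
  then have "card {c \<in> C. joined T r res (lab c) u} * card C \<le> 1 * card C"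
    by (rule mult_right_mono) simp
  then show ?case
    unfolding result.simps by linarith
next
  case (Ask x y f)
  let ?J = "\<lambda>f C. {c \<in> C. joined T r (result (w c) (f (w c x y))) (lab c) u}"
  let ?Q = "\<lambda>C. \<Sum>c\<in>C. touching u (queries (w c) (f (w c x y)))"
  define h where "h = (if x = u \<or> y = u then 1 else 0 :: nat)"
  have "touching u ((x, y) # qs) = h + touching u qs" for qs
    by (simp add: touching_def h_def)
  then have t: "(\<Sum>c\<in>C. touching u (queries (w c) (Ask x y f))) = h * card C + ?Q C"
    by (simp only: queries.simps sum.distrib sum_constant mult.commute[of h] of_nat_id)
  have const: "card (?J f D) * card D \<le> card D + 2 * ?Q D" if "finite D" "\<And>c. c \<in> D \<Longrightarrow> w c x y = z" for D z
  proof -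
    have "?J f D = {c \<in> D. joined T r (result (w c) (f z)) (lab c) u}"
      using that by auto
    moreover have "?Q D = (\<Sum>c\<in>D. touching u (queries (w c) (f z)))"
      using that by (intro sum.cong) auto
    ultimately show ?thesis
      using Ask.IH[OF rangeI, of D z] that(1) by simp
  qed
  show ?case
  proof (cases "(x = u) = (y = u)")
    case True
    \<comment> \<open>A query with both ends or no end at \<open>u\<close> has the same answer for
      all labels of \<open>u\<close>.\<close>
    then have "w c x y = w 0 x y" for c
      by (auto simp: w_def cluster_metric_def lab)
    from const[of C, OF Ask.prems this]
    have "card (?J f C) * card C \<le> card C + 2 * ?Q C" .
    also have "\<dots> \<le> card C + 2 * (h * card C + ?Q C)"
      by (intro add_left_mono mult_left_mono) simp_all
    finally show ?thesis
      by (simp only: t result.simps)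
  next
    case False
    define v where "v = (if x = u then y else x)"
    have v: "v \<noteq> u" and w: "w c x y = (if v \<in> T \<and> l v = c then 1 else L)" for c
      using False assms(2) by (auto simp: w_def cluster_metric_def v_def lab)
    have h: "h = 1"
      using False by (auto simp: h_def)
    define D where "D = C - (if v \<in> T then {l v} else {})"
    have IH: "card (?J f D) * card D \<le> card D + 2 * ?Q D"
      by (rule const[of _ L]) (use Ask.prems in \<open>auto simp: w D_def\<close>)
    show ?thesis
    proof (cases "v \<in> T \<and> l v \<in> C")
      case False
      then have "D = C" by (auto simp: D_def)
      with IH have "card (?J f C) * card C \<le> card C + 2 * ?Q C"
        by (simp only:)
      also have "\<dots> \<le> card C + 2 * (h * card C + ?Q C)"
        by (intro add_left_mono mult_left_mono) simp_all
      finally show ?thesis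
        by (simp only: t result.simps)
    next
      case True
      then have D: "card C = Suc (card D)" "finite D" and C: "C = insert (l v) D"
        using Ask.prems card_Suc_Diff1[of C "l v"] by (auto simp: D_def)
      have "card (?J f C) \<le> card (insert (l v) (?J f D))"
        using D(2) C by (intro card_mono) auto
      also have "\<dots> \<le> Suc (card (?J f D))"
        by (rule card_insert_le_m1) auto
      finally have M: "card (?J f C) \<le> Suc (card (?J f D))" .
      have M': "card (?J f D) \<le> card D"
        using D(2) by (intro card_mono) auto
      have Q: "?Q D \<le> ?Q C"
        using Ask.prems C by (intro sum_mono2) auto
      \<comment> \<open>The factor 2 in the statement originates here. With
        \<open>j = card (?J f D)\<close> and \<open>d = card D\<close>, the separated label may add
        \<open>j + d + 1\<close> to \<open>j * d\<close>. The query counts once for each of the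
        \<open>d + 1\<close> labels, and twice this is enough as \<open>j \<le> d\<close>.\<close>
      have "card (?J f C) * card C \<le> Suc (card (?J f D)) * Suc (card D)"
        using M D(1) by (intro mult_mono) auto
      also have "\<dots> = card (?J f D) * card D + card (?J f D) + card D + 1"
        by simp
      also have "\<dots> \<le> card C + 2 * (card C + ?Q C)"
      proof -
        have "p + j + d + 1 \<le> Suc d + 2 * (Suc d + q')"
          if "p \<le> d + 2 * q" "j \<le> d" "q \<le> q'" for p j d q q' :: nat
          using that by presburger
        from this[OF IH M' Q] show ?thesis
          unfolding D(1) .
      qed
      finally show ?thesis
        by (simp only: t h result.simps mult_1)
    qed
  qed
qed

text \<open>Resampling at \<open>u\<close>: exchanging the old value with the new one is an
  involution on the pairs \<open>(l, c)\<close>.\<close>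

lemma sum_PiE_fibres:
  fixes F :: "('a \<Rightarrow> 'b) \<Rightarrow> real"
  assumes "finite T" "u \<in> T" "finite C"
  shows "(\<Sum>l\<in>T \<rightarrow>\<^sub>E C. \<Sum>c\<in>C. F (l(u := c))) = card C * (\<Sum>l\<in>T \<rightarrow>\<^sub>E C. F l)"
proof -
  have fin: "finite (T \<rightarrow>\<^sub>E C)"
    using assms by (intro finite_PiE) auto
  have "(\<Sum>l\<in>T \<rightarrow>\<^sub>E C. \<Sum>c\<in>C. F (l(u := c))) = (\<Sum>(l, c)\<in>(T \<rightarrow>\<^sub>E C) \<times> C. F (l(u := c)))"
    by (simp add: sum.cartesian_product)
  also have "\<dots> = (\<Sum>(l, c)\<in>(T \<rightarrow>\<^sub>E C) \<times> C. F l)"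
    by (rule sum.reindex_bij_witness[where i = "\<lambda>(l, c). (l(u := c), l u)"
          and j = "\<lambda>(l, c). (l(u := c), l u)"])
      (use assms(2) in \<open>auto simp: PiE_iff extensional_def fun_eq_iff\<close>)
  also have "\<dots> = (\<Sum>l\<in>T \<rightarrow>\<^sub>E C. \<Sum>c\<in>C. F l)"
    by (rule sum.cartesian_product[symmetric])
  also have "\<dots> = card C * (\<Sum>l\<in>T \<rightarrow>\<^sub>E C. F l)"
    by (simp add: sum_distrib_left)
  finally show ?thesis .
qed

lemma sum_touching_le:
  assumes "finite T"
  shows "(\<Sum>u\<in>T. touching u qs) \<le> 2 * length qs"
proof (induction qs)
  case (Cons e qs)
  obtain x y where e: "e = (x, y)" by fastforce
  have "(\<Sum>u\<in>T. touching u (e # qs)) =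
      (\<Sum>u\<in>T. if x = u \<or> y = u then 1 else 0) + (\<Sum>u\<in>T. touching u qs)"
    unfolding sum.distrib[symmetric] by (intro sum.cong) (auto simp: touching_def e)
  also have "(\<Sum>u\<in>T. if x = u \<or> y = u then 1 else 0) = card {u \<in> T. x = u \<or> y = u}"
    using assms by (simp add: sum.If_cases Int_def)
  also have "\<dots> \<le> card {x, y}"
    by (intro card_mono) auto
  also have "\<dots> \<le> 2"
    by (simp add: card_insert_if)
  finally show ?case
    using Cons.IH by simp
qed (simp add: touching_def)

text \<open>For each terminal, \<open>joined_labels_le\<close> is applied on the fibre where all
  other labels are fixed. The 4 is the factor 2 from there times the two ends of a query.\<close>

lemma sum_joined_le:
  fixes L :: real
  assumes "finite T" "m > 0"
  defines "w \<equiv> cluster_metric T L"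
  shows "real m * (\<Sum>l\<in>T \<rightarrow>\<^sub>E {..<m}. real (card {u \<in> T. joined T r (result (w l) A) l u}))
    \<le> (\<Sum>l\<in>T \<rightarrow>\<^sub>E {..<m}. real (card T) + 4 * real (length (queries (w l) A)))"
proof -
  let ?\<Omega> = "T \<rightarrow>\<^sub>E {..<m}"
  define J where "J u l = (of_bool (joined T r (result (w l) A) l u) :: real)" for u l
  define Q where "Q u l = real (touching u (queries (w l) A))" for u l
  have vertex: "real m * (\<Sum>l\<in>?\<Omega>. J u l) \<le> (\<Sum>l\<in>?\<Omega>. 1 + 2 * Q u l)" if u: "u \<in> T" for u
  proof -
    have fibre: "(\<Sum>c<m. J u (l(u := c))) * m \<le> (\<Sum>c<m. 1 + 2 * Q u (l(u := c)))" for l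
    proof -
      define lab where "lab c = l(u := c)" for c
      have lab: "lab c u = c" "v \<noteq> u \<Longrightarrow> lab c v = l v" for c v
        by (simp_all add: lab_def)
      have "real (card {c \<in> {..<m}. joined T r (result (w (lab c)) A) (lab c) u} * card {..<m})
          \<le> real (card {..<m} + 2 * (\<Sum>c<m. touching u (queries (w (lab c)) A)))"
        unfolding of_nat_le_iff w_def
        by (rule joined_labels_le[where l = l]) (use u lab in simp_all)
      also have "\<dots> = (\<Sum>c<m. 1 + 2 * Q u (lab c))"
        by (simp add: Q_def sum.distrib sum_distrib_left)
      finally show ?thesis
        by (simp add: J_def lab_def Int_def)
    qed
    \<comment> \<open>One factor \<open>m\<close> belongs to the fibre inequality; the other comes
      from resampling, occurs on both sides and cancels.\<close>
    have "real m * (real m * (\<Sum>l\<in>?\<Omega>. J u l)) = (\<Sum>l\<in>?\<Omega>. (\<Sum>c<m. J u (l(u := c))) * m)"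
      using sum_PiE_fibres[of T u "{..<m}" "J u"] u assms(1)
      by (simp add: sum_distrib_right[symmetric])
    also have "\<dots> \<le> (\<Sum>l\<in>?\<Omega>. \<Sum>c<m. 1 + 2 * Q u (l(u := c)))"
      by (intro sum_mono fibre)
    also have "\<dots> = real m * (\<Sum>l\<in>?\<Omega>. 1 + 2 * Q u l)"
      using sum_PiE_fibres[of T u "{..<m}" "\<lambda>l. 1 + 2 * Q u l"] u assms(1) by simp
    finally show ?thesis
      using assms(2) by simp
  qed
  have "real m * (\<Sum>l\<in>?\<Omega>. real (card {u \<in> T. joined T r (result (w l) A) l u}))
      = (\<Sum>u\<in>T. real m * (\<Sum>l\<in>?\<Omega>. J u l))"
    unfolding sum_distrib_left[symmetric] using assms(1)
    by (subst sum.swap) (simp add: J_def Int_def)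
  also have "\<dots> \<le> (\<Sum>u\<in>T. \<Sum>l\<in>?\<Omega>. 1 + 2 * Q u l)"
    by (intro sum_mono vertex)
  also have "\<dots> = (\<Sum>l\<in>?\<Omega>. real (card T) + 2 * real (\<Sum>u\<in>T. touching u (queries (w l) A)))"
    by (subst sum.swap) (simp add: Q_def sum.distrib sum_distrib_left)
  also have "\<dots> \<le> (\<Sum>l\<in>?\<Omega>. real (card T) + 4 * real (length (queries (w l) A)))"
  proof (intro sum_mono)
    fix l
    show "real (card T) + 2 * real (\<Sum>u\<in>T. touching u (queries (w l) A))
        \<le> real (card T) + 4 * real (length (queries (w l) A))"
      using sum_touching_le[OF assms(1), of "queries (w l) A"] by linarith
  qed
  finally show ?thesis .
qed

text \<open>The constants meet here. Each success has at least \<open>k / 2\<close> joined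
  terminals; weighted by \<open>m \<ge> k / (16 * \<alpha>)\<close> this is at least
  \<open>Z / 32\<close>. Per instance \<open>k + 4 * (Z / 1024)\<close> is available, at most
  \<open>3 * Z / 256\<close>, because \<open>k \<ge> 128 * \<alpha>\<close> means
  \<open>128 * k \<le> Z\<close>. The quotient is 3/8, safely below 2/3.\<close>

lemma card_successes_le:
  fixes T :: "nat set" and \<alpha> :: real
  assumes T: "T \<subseteq> {..<n}" and \<alpha>: "\<alpha> \<ge> 2" and k: "real (card T) \<ge> 128 * \<alpha>"
  defines "m \<equiv> nat \<lfloor>real (card T) / (8 * \<alpha>)\<rfloor>"
  defines "w \<equiv> cluster_metric T (card T)"
  assumes q: "\<And>l. l \<in> T \<rightarrow>\<^sub>E {..<m} \<Longrightarrow>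
      real (length (queries (w l) A)) \<le> real (card T) ^ 2 / \<alpha> / 1024"
  shows "real (card {l \<in> T \<rightarrow>\<^sub>E {..<m}. succeeds \<alpha> {..<n} T (w l) A})
    \<le> 3 / 8 * real (card (T \<rightarrow>\<^sub>E {..<m}))"
proof -
  let ?\<Omega> = "T \<rightarrow>\<^sub>E {..<m}"
  define k where "k = real (card T)"
  have k128: "k \<ge> 128 * \<alpha>" and k_pos: "k \<ge> 1" "k > 0"
    using k \<alpha> by (auto simp: k_def)
  have fin: "finite T" and ne: "T \<noteq> {}"
    using T finite_subset k_pos by (blast, auto simp: k_def)
  obtain r where r: "r \<in> T" using ne by blast
  have fin\<Omega>: "finite ?\<Omega>"
    using fin by (intro finite_PiE) auto
  define Z where "Z = k ^ 2 / \<alpha>"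
  define x where "x = k / (8 * \<alpha>)"
  have x: "2 \<le> x" "k / (16 * \<alpha>) = x / 2"
    using k128 \<alpha> by (simp_all add: x_def field_simps)
  have m: "m = nat \<lfloor>x\<rfloor>"
    by (simp add: m_def x_def k_def)
  have m_le: "real m \<le> k / (8 * \<alpha>)" and m_ge: "real m \<ge> k / (16 * \<alpha>)" and "m > 0"
    unfolding x(2) x_def[symmetric] using x(1) m by linarith+
  define B where "B l = real (card {u \<in> T. joined T r (result (w l) A) l u})" for l
  have many: "B l \<ge> k / 2" if l: "l \<in> ?\<Omega>" and succ: "succeeds \<alpha> {..<n} T (w l) A" for l
  proof -
    obtain G where G: "result (w l) A = Some G" "steiner_tree {..<n} T G"
      "cost (w l) G \<le> \<alpha> * ST {..<n} T (w l)"
      using succ by (auto simp: succeeds_def approx_steiner_tree_def)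
    have "card (l ` T) \<le> card {..<m}"
      using l by (intro card_mono) auto
    then have "real (card (l ` T)) * k \<le> m * k"
      using k_pos by (intro mult_right_mono) auto
    moreover have "ST {..<n} T (w l) \<le> k + real (card (l ` T)) * k"
      using ST_cluster_metric_le[OF T ne, of k l] k_pos by (simp add: w_def flip: k_def)
    ultimately have "ST {..<n} T (w l) \<le> k + m * k"
      by linarith
    then have "\<alpha> * ST {..<n} T (w l) \<le> \<alpha> * (k + m * k)"
      using \<alpha> by (intro mult_left_mono) auto
    moreover have "k * (k - 1 - B l) \<le> cost (w l) G"
      using cost_cluster_metric_ge[OF G(2) r, of k l] k_pos
      unfolding B_def G(1) by (simp add: w_def k_def)
    ultimately have "k * (k - 1 - B l) \<le> k * (\<alpha> + \<alpha> * m)"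
      using G(3) by (simp add: algebra_simps)
    \<comment> \<open>With \<open>L = k\<close> all unit edges of the cheap tree together weigh no
      more than one long edge. Dividing by \<open>k\<close> leaves at most
      \<open>\<alpha> + \<alpha> * m\<close> long edges, a bound of at most
      \<open>k / 128 + k / 8\<close>.\<close>
    then have "k - 1 - B l \<le> \<alpha> + \<alpha> * m"
      using k_pos by simp
    moreover have "\<alpha> * m \<le> k / 8"
      using m_le \<alpha> by (simp add: field_simps)
    ultimately show ?thesis
      using k128 \<alpha> by linarith
  qed
  let ?S = "{l \<in> ?\<Omega>. succeeds \<alpha> {..<n} T (w l) A}"
  have "k / 2 * real (card ?S) = (\<Sum>l\<in>?S. k / 2)"
    by simp
  also have "\<dots> \<le> (\<Sum>l\<in>?S. B l)"
    using many by (intro sum_mono) auto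
  also have "\<dots> \<le> (\<Sum>l\<in>?\<Omega>. B l)"
    using fin\<Omega> by (intro sum_mono2) (auto simp: B_def)
  finally have "real m * (k / 2 * real (card ?S)) \<le> real m * (\<Sum>l\<in>?\<Omega>. B l)"
    by (intro mult_left_mono) auto
  also have "\<dots> \<le> (\<Sum>l\<in>?\<Omega>. k + 4 * real (length (queries (w l) A)))"
    using sum_joined_le[OF fin \<open>m > 0\<close>, of r "card T" A] by (simp add: B_def w_def k_def)
  also have "\<dots> \<le> (\<Sum>l\<in>?\<Omega>. k + 4 * (Z / 1024))"
    using q by (intro sum_mono add_left_mono mult_left_mono) (auto simp: k_def Z_def)
  also have "\<dots> = real (card ?\<Omega>) * (k + Z / 256)"
    by simp
  finally have "real m * (k / 2 * real (card ?S)) \<le> real (card ?\<Omega>) * (k + Z / 256)" .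
  moreover have "k / (16 * \<alpha>) * (k / 2 * real (card ?S)) \<le> real m * (k / 2 * real (card ?S))"
    using m_ge k_pos by (intro mult_right_mono) auto
  moreover have "real (card ?\<Omega>) * (k + Z / 256) \<le> real (card ?\<Omega>) * (Z * (3 / 256))"
  proof (intro mult_left_mono)
    have "128 * \<alpha> * k \<le> k * k"
      using k128 k_pos by (intro mult_right_mono) auto
    then have "128 * k \<le> Z"
      using \<alpha> by (simp add: Z_def pos_le_divide_eq power2_eq_square mult_ac)
    then show "k + Z / 256 \<le> Z * (3 / 256)"
      by simp
  qed simp
  ultimately have "k / (16 * \<alpha>) * (k / 2 * real (card ?S)) \<le> real (card ?\<Omega>) * (Z * (3 / 256))"
    by linarith
  moreover have "k / (16 * \<alpha>) * (k / 2 * real (card ?S)) = Z / 32 * real (card ?S)"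
    by (simp add: Z_def power2_eq_square)
  moreover have "real (card ?\<Omega>) * (Z * (3 / 256)) = Z / 32 * (3 / 8 * real (card ?\<Omega>))"
    by simp
  ultimately have "Z / 32 * real (card ?S) \<le> Z / 32 * (3 / 8 * real (card ?\<Omega>))"
    by (simp only:)
  moreover have "Z / 32 > 0"
    using k_pos \<alpha> by (simp add: Z_def)
  ultimately show ?thesis
    by (simp only: mult_le_cancel_left_pos)
qed

text \<open>Yao's principle: the average of the success probabilities over the instances is the average
  over the seeds of the number of instances solved.\<close>

lemma (in prob_space) average_success_le:
  assumes fin: "finite I" and ev: "\<And>i. i \<in> I \<Longrightarrow> E i \<in> events"
    and ae: "AE \<omega> in M. real (card {i \<in> I. \<omega> \<in> E i}) \<le> b"
  shows "(\<Sum>i\<in>I. prob (E i)) \<le> b"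
proof -
  have "(\<Sum>i\<in>I. prob (E i)) = (\<Sum>i\<in>I. integral\<^sup>L M (indicator (E i)))"
    using ev by simp
  also have "\<dots> = (\<integral>\<omega>. (\<Sum>i\<in>I. indicator (E i) \<omega>) \<partial>M)"
    using ev by (subst Bochner_Integration.integral_sum) (auto simp: emeasure_eq_measure)
  also have "\<dots> \<le> (\<integral>\<omega>. b \<partial>M)"
  proof (rule integral_mono_AE)
    show "integrable M (\<lambda>\<omega>. \<Sum>i\<in>I. indicator (E i) \<omega> :: real)"
      using ev by (intro Bochner_Integration.integrable_sum) (auto simp: emeasure_eq_measure)
    show "AE \<omega> in M. (\<Sum>i\<in>I. indicator (E i) \<omega>) \<le> b"
      using ae
    proof eventually_elim
      case (elim \<omega>)
      then show ?case
        using fin by (simp add: indicator_def Int_def)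
    qed
  qed simp
  finally show ?thesis
    by (simp add: prob_space)
qed

lemma query_lower_bound:
  fixes \<alpha> :: real and T :: "nat set"
  assumes \<alpha>: "\<alpha> \<ge> 2" and T: "T \<subseteq> {..<n}" and k: "real (card T) \<ge> 128 * \<alpha>"
    and M: "prob_space M"
    and success: "\<And>w. Metric_space {..<n} w \<Longrightarrow>
      measure M {\<omega> \<in> space M. succeeds \<alpha> {..<n} T w (A \<omega>)} \<ge> 2 / 3"
  shows "\<exists>w. Metric_space {..<n} w \<and>
    \<not> (AE \<omega> in M. real (length (queries w (A \<omega>))) < 1 / 1024 * (real (card T) ^ 2 / \<alpha>))"
proof (rule ccontr)
  interpret prob_space M by (rule M)
  assume "\<not> ?thesis"
  then have few: "AE \<omega> in M. real (length (queries w (A \<omega>))) < 1 / 1024 * (real (card T) ^ 2 / \<alpha>)"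
    if "Metric_space {..<n} w" for w
    using that by blast
  define m where "m = nat \<lfloor>real (card T) / (8 * \<alpha>)\<rfloor>"
  define w where "w = cluster_metric T (card T)"
  define E where "E l = {\<omega> \<in> space M. succeeds \<alpha> {..<n} T (w l) (A \<omega>)}" for l
  let ?\<Omega> = "T \<rightarrow>\<^sub>E {..<m}"
  have k1: "real (card T) \<ge> 1"
    using k \<alpha> by linarith
  have metric: "Metric_space {..<n} (w l)" for l
    unfolding w_def by (rule Metric_space_cluster_metric[OF k1])
  have fin: "finite ?\<Omega>"
    using T finite_subset by (intro finite_PiE) auto
  have "m > 0"
  proof -
    have "1 \<le> real (card T) / (8 * \<alpha>)"
      using k \<alpha> by (simp add: field_simps)
    then show ?thesis
      unfolding m_def by linarith
  qed
  then have pos: "card ?\<Omega> > 0"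
    using fin by (auto simp: card_gt_0_iff PiE_eq_empty_iff)
  have prob: "prob (E l) \<ge> 2 / 3" for l
    using success[OF metric] by (simp add: E_def)
  \<comment> \<open>There are finitely many instances, so almost every seed is cheap on all of them
    at once.\<close>
  have "AE \<omega> in M. \<forall>l\<in>?\<Omega>. real (length (queries (w l) (A \<omega>))) < 1 / 1024 * (real (card T) ^ 2 / \<alpha>)"
    using few[OF metric] by (intro AE_finite_allI[OF fin]) auto
  then have ae: "AE \<omega> in M. real (card {l \<in> ?\<Omega>. \<omega> \<in> E l}) \<le> 3 / 8 * real (card ?\<Omega>)"
    using AE_space
  proof eventually_elim
    case (elim \<omega>)
    have "real (card {l \<in> ?\<Omega>. succeeds \<alpha> {..<n} T (w l) (A \<omega>)}) \<le> 3 / 8 * real (card ?\<Omega>)"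
      unfolding m_def w_def
      by (rule card_successes_le[OF T \<alpha> k]) (use elim(1) in \<open>auto simp: m_def w_def less_imp_le\<close>)
    then show ?case
      using elim(2) by (simp add: E_def)
  qed
  have "(\<Sum>l\<in>?\<Omega>. prob (E l)) \<le> 3 / 8 * real (card ?\<Omega>)"
  proof (rule average_success_le[OF fin _ ae])
    fix l
    show "E l \<in> events"
      \<comment> \<open>\<open>measure\<close> vanishes outside the events, so a success probability
        of at least 2/3 already entails measurability.\<close>
      using prob[of l] measure_notin_sets[of "E l" M] by force
  qed
  moreover have "(\<Sum>l\<in>?\<Omega>. 2 / 3) \<le> (\<Sum>l\<in>?\<Omega>. prob (E l))"
    by (intro sum_mono prob)
  ultimately show False
    using pos by simp
qed

theorem theorem1p5:
  shows
   "(\<forall>c::real. c > 0 \<longrightarrow> (\<exists>(C::real) (d::nat). \<forall>\<alpha>::real. \<alpha> \<ge> 2 \<longrightarrow>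
      (\<exists>(P::com) (a::nat) (b::nat). \<forall>(n::nat) (T::nat set) (w::nat \<Rightarrow> nat \<Rightarrow> real).
         T \<subseteq> {..<n} \<longrightarrow> T \<noteq> {} \<longrightarrow> Metric_space {..<n} w \<longrightarrow>
         (let k = card T; A = (\<lambda>\<omega>. exec (a * n ^ b) \<omega> [P] (input n T)) in
           (\<forall>\<omega>. result w (A \<omega>) \<noteq> None \<and>
                set (queries w (A \<omega>)) \<subseteq> {..<n} \<times> {..<n} \<and>
                real (length (queries w (A \<omega>))) \<le> C * (real k ^ 2 / \<alpha>) * (1 + ln (real k)) ^ d) \<and>
           measure fair_coins {\<omega> \<in> space fair_coins. succeeds \<alpha> {..<n} T w (A \<omega>)}
             \<ge> 1 - real n powr (- c)))))
    \<and>
    (\<exists>c::real. c > 0 \<and> (\<forall>\<alpha>::real. \<alpha> \<ge> 2 \<longrightarrow> (\<exists>k\<^sub>0::nat.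
      \<forall>(n::nat) (T::nat set) (M::(nat \<Rightarrow> bool) measure) (A::(nat \<Rightarrow> bool) \<Rightarrow> dtree).
         T \<subseteq> {..<n} \<longrightarrow> card T \<ge> k\<^sub>0 \<longrightarrow> prob_space M \<longrightarrow>
         (\<forall>w. Metric_space {..<n} w \<longrightarrow>
            (\<forall>\<omega> \<in> space M. set (queries w (A \<omega>)) \<subseteq> {..<n} \<times> {..<n}) \<and>
            measure M {\<omega> \<in> space M. succeeds \<alpha> {..<n} T w (A \<omega>)} \<ge> 2 / 3) \<longrightarrow>
         (\<exists>w. Metric_space {..<n} w \<and>
            \<not> (AE \<omega> in M. real (length (queries w (A \<omega>))) < c * (real (card T) ^ 2 / \<alpha>))))))"
proof (intro conjI allI impI)
  fix c :: real
  show "\<exists>(C::real) (d::nat). \<forall>\<alpha>::real. \<alpha> \<ge> 2 \<longrightarrow>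
      (\<exists>(P::com) (a::nat) (b::nat). \<forall>(n::nat) (T::nat set) (w::nat \<Rightarrow> nat \<Rightarrow> real).
         T \<subseteq> {..<n} \<longrightarrow> T \<noteq> {} \<longrightarrow> Metric_space {..<n} w \<longrightarrow>
         (let k = card T; A = (\<lambda>\<omega>. exec (a * n ^ b) \<omega> [P] (input n T)) in
           (\<forall>\<omega>. result w (A \<omega>) \<noteq> None \<and>
                set (queries w (A \<omega>)) \<subseteq> {..<n} \<times> {..<n} \<and>
                real (length (queries w (A \<omega>))) \<le> C * (real k ^ 2 / \<alpha>) * (1 + ln (real k)) ^ d) \<and>
           measure fair_coins {\<omega> \<in> space fair_coins. succeeds \<alpha> {..<n} T w (A \<omega>)}
             \<ge> 1 - real n powr (- c)))"
    by (intro exI[of _ 6] exI[of _ 0] allI impI) (rule query_upper_bound)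
next
  show "\<exists>c::real. c > 0 \<and> (\<forall>\<alpha>::real. \<alpha> \<ge> 2 \<longrightarrow> (\<exists>k\<^sub>0::nat.
      \<forall>(n::nat) (T::nat set) (M::(nat \<Rightarrow> bool) measure) (A::(nat \<Rightarrow> bool) \<Rightarrow> dtree).
         T \<subseteq> {..<n} \<longrightarrow> card T \<ge> k\<^sub>0 \<longrightarrow> prob_space M \<longrightarrow>
         (\<forall>w. Metric_space {..<n} w \<longrightarrow>
            (\<forall>\<omega> \<in> space M. set (queries w (A \<omega>)) \<subseteq> {..<n} \<times> {..<n}) \<and>
            measure M {\<omega> \<in> space M. succeeds \<alpha> {..<n} T w (A \<omega>)} \<ge> 2 / 3) \<longrightarrow>
         (\<exists>w. Metric_space {..<n} w \<and>
            \<not> (AE \<omega> in M. real (length (queries w (A \<omega>))) < c * (real (card T) ^ 2 / \<alpha>)))))"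
  proof (intro exI[of _ "1 / 1024 :: real"] conjI allI impI)
    fix \<alpha> :: real
    assume \<alpha>: "\<alpha> \<ge> 2"
    show "\<exists>k\<^sub>0::nat.
      \<forall>(n::nat) (T::nat set) (M::(nat \<Rightarrow> bool) measure) (A::(nat \<Rightarrow> bool) \<Rightarrow> dtree).
         T \<subseteq> {..<n} \<longrightarrow> card T \<ge> k\<^sub>0 \<longrightarrow> prob_space M \<longrightarrow>
         (\<forall>w. Metric_space {..<n} w \<longrightarrow>
            (\<forall>\<omega> \<in> space M. set (queries w (A \<omega>)) \<subseteq> {..<n} \<times> {..<n}) \<and>
            measure M {\<omega> \<in> space M. succeeds \<alpha> {..<n} T w (A \<omega>)} \<ge> 2 / 3) \<longrightarrow>
         (\<exists>w. Metric_space {..<n} w \<and>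
            \<not> (AE \<omega> in M. real (length (queries w (A \<omega>))) < 1 / 1024 * (real (card T) ^ 2 / \<alpha>)))"
    proof (intro exI[of _ "nat \<lceil>128 * \<alpha>\<rceil>"] allI impI)
      fix n T and M :: "(nat \<Rightarrow> bool) measure" and A
      assume T: "T \<subseteq> {..<n}" "nat \<lceil>128 * \<alpha>\<rceil> \<le> card T" and M: "prob_space M"
        and A: "\<forall>w. Metric_space {..<n} w \<longrightarrow>
            (\<forall>\<omega> \<in> space M. set (queries w (A \<omega>)) \<subseteq> {..<n} \<times> {..<n}) \<and>
            measure M {\<omega> \<in> space M. succeeds \<alpha> {..<n} T w (A \<omega>)} \<ge> 2 / 3"
      have "real (card T) \<ge> 128 * \<alpha>"
        using T(2) by linarith
      then show "\<exists>w. Metric_space {..<n} w \<and>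
            \<not> (AE \<omega> in M. real (length (queries w (A \<omega>))) < 1 / 1024 * (real (card T) ^ 2 / \<alpha>))"
        using A by (intro query_lower_bound[OF \<alpha> T(1) _ M]) auto
    qed
  qed simp
qed

end
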